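(* Let $\mathcal H\triangleq\{H_x\}_{x\in\mathcal X}\cup\{\Xi\}$, where $H_x=\{\xi\in\Xi: f(\xi,x)<+\infty\}$, and let $\xi^{[N]}=(\xi_1,\dots,\xi_N)$ be IID samples from $\mathbb P$ (so $\xi^{[N]}\sim\mathbb P^N$). Assume $\mathcal H$ has finite VC dimension $d_{VC}(\mathcal H)=d<+\infty$. Assume moreover that the SAA feasible region $\mathrm{dom}\,\hat F_N=\bigcap_{i=1}^N\{x\in\mathcal X: f(\xi_i,x)<+\infty\}$ is non-empty with probability 1, and let $x^\star(\xi^{[N]})\in\mathcal X$ be the output of any algorithm that is guaranteed to be within $\mathrm{dom}\,\hat F_N$. Then, for any $0<\delta,\epsilon<1$, if $$N\ \ge\ \frac{4}{\epsilon}\Big(d\log\big(\tfrac{12}{\epsilon}\big)+\log\big(\tfrac{2}{\delta}\big)\Big),$$ we have $$\mathbb P^N\Big(\sup_{x\in \mathrm{dom}\,\hat F_N}V(x)>\epsilon\Big)\le\delta,$$ and consequently $$\mathbb P^N\big(V(x^\star(\xi^{[N]}))>\epsilon\big)\le\delta .$$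
   Context: Setting. $(\Omega,\mathcal F,\mathbb P)$ is a complete probability space and $\xi:\Omega\to\Xi\subseteq\mathbb R^r$ is a random vector ($\mathbb P$ also denotes its law on $\Xi$). $\mathcal X$ is a nonempty closed subset of a Polish space, with Borel $\sigma$-algebra $\mathscr B$. $f$ is a function of $(\xi,x)\in\Xi\times\mathcal X$ with values in $\mathbb R\cup\{+\infty\}$, such that $f(\xi,\cdot)$ is lower semicontinuous for each realization of $\xi$ and $(\omega,x)\mapsto f(\xi(\omega),x)$ is measurable with respect to the completion of $\mathcal F\otimes\mathscr B$. Put $F(x)=\mathbb E[f(\xi,x)]$; the set $\{x\in\mathcal X:F(x)<+\infty\}$ is assumed non-empty. All quantities of interest are assumed measurable. $\mathbb P^N$ is the joint law of $N$ IID samples of $\xi$. The stochastic program is $\inf_{x\in\mathcal X}F(x)$ and its sample average approximation (SAA) is $\inf_{x\in\mathcal X}\hat F_N(x)$ with $\hat F_N(x)=\frac1N\sum_{i=1}^N f(\xi_i,x)$. Write $\mathrm{dom}\,f_\xi=\{x\in\mathcal X:f(\xi,x)<+\infty\}$ and define the violation probability $V(x)=\mathbb P(\xi\in\Xi: x\notin\mathrm{dom}\,f_\xi)$ for $x\in\mathcal X$. VC dimension: a class $\mathcal H$ of subsets of a set shatters a finite set of points $S$ if for every $D\subseteq S$ there is $C\in\mathcal H$ with $D\subseteq C$ and $(S\setminus D)\cap C=\emptyset$; $d_{VC}(\mathcal H)$ is the maximal cardinality of a finite set shattered by $\mathcal H$ ($+\infty$ if unbounded). $\log$ is the natural logarithm.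 *)

theory Defs
  imports "HOL-Probability.Probability"
begin

section \<open>VC dimension\<close>

definition shatters :: "'a set set \<Rightarrow> 'a set \<Rightarrow> bool" where
  "shatters H S \<longleftrightarrow> finite S \<and> (\<forall>D\<subseteq>S. \<exists>C\<in>H. D \<subseteq> C \<and> (S - D) \<inter> C = {})"

definition vc_dim :: "'a set set \<Rightarrow> enat" where
  "vc_dim H = (SUP S\<in>{S. shatters H S}. enat (card S))"

section \<open>Random lower semicontinuous integrands\<close>

definition lsc_on :: "'x::topological_space set \<Rightarrow> ('x \<Rightarrow> ereal) \<Rightarrow> bool" where
  "lsc_on X g \<longleftrightarrow> (\<forall>x\<in>X. g x \<le> Liminf (at x within X) g)"

text \<open>No measure is given on the second factor, so the product sigma-algebra of a probability
  space \<open>M\<close> and a measurable space \<open>B\<close> is completed with respect to the measure of \<open>M\<close>: one adjoins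
  all subsets of the cylinders over null sets of \<open>M\<close>. (The measure component of this object
  is irrelevant; it is the zero measure.)\<close>

definition prod_completion :: "'a measure \<Rightarrow> 'b measure \<Rightarrow> ('a \<times> 'b) measure" where
  "prod_completion M B = sigma (space M \<times> space B)
     (sets (M \<Otimes>\<^sub>M B) \<union> {E. \<exists>Z\<in>null_sets M. E \<subseteq> Z \<times> space B})"

text \<open>The expectation of an extended real random variable, as the integral of the positive part
  minus the integral of the negative part. If both are infinite, the value is \<open>\<infinity>\<close>,
  because \<open>\<infinity> - \<infinity> = \<infinity>\<close> in \<^typ>\<open>ereal\<close>. So the value is below \<open>\<infinity>\<close> iff the positive part
  has a finite integral.\<close>

definition ereal_expectation :: "'a measure \<Rightarrow> ('a \<Rightarrow> ereal) \<Rightarrow> ereal" where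
  "ereal_expectation M g =
     enn2ereal (\<integral>\<^sup>+ \<omega>. e2ennreal (g \<omega>) \<partial>M) - enn2ereal (\<integral>\<^sup>+ \<omega>. e2ennreal (- g \<omega>) \<partial>M)"

section \<open>Laws, feasible sets and violation probability\<close>

text \<open>The laws are completed, so that ``measurable'' below means measurable up to null sets.\<close>

definition law :: "'w measure \<Rightarrow> 'z::topological_space set \<Rightarrow> ('w \<Rightarrow> 'z) \<Rightarrow> 'z measure" where
  "law M \<Xi> \<xi> = completion (distr M (restrict_space borel \<Xi>) \<xi>)"

definition sample_law ::
  "'w measure \<Rightarrow> 'z::topological_space set \<Rightarrow> ('w \<Rightarrow> 'z) \<Rightarrow> nat \<Rightarrow> (nat \<Rightarrow> 'z) measure" where
  "sample_law M \<Xi> \<xi> N = completion (Pi\<^sub>M {1..N} (\<lambda>_. law M \<Xi> \<xi>))"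

definition dom_at :: "'x set \<Rightarrow> ('z \<Rightarrow> 'x \<Rightarrow> ereal) \<Rightarrow> 'z \<Rightarrow> 'x set" where
  "dom_at X f z = {x\<in>X. f z x < \<infinity>}"

text \<open>The intersection with \<open>X\<close> only matters for \<open>N = 0\<close>.\<close>

definition saa_dom :: "'x set \<Rightarrow> ('z \<Rightarrow> 'x \<Rightarrow> ereal) \<Rightarrow> nat \<Rightarrow> (nat \<Rightarrow> 'z) \<Rightarrow> 'x set" where
  "saa_dom X f N s = X \<inter> (\<Inter>i\<in>{1..N}. dom_at X f (s i))"

definition feasible_scenarios :: "'z set \<Rightarrow> ('z \<Rightarrow> 'x \<Rightarrow> ereal) \<Rightarrow> 'x \<Rightarrow> 'z set" where
  "feasible_scenarios \<Xi> f x = {z\<in>\<Xi>. f z x < \<infinity>}"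

definition violation ::
  "'w measure \<Rightarrow> 'z::topological_space set \<Rightarrow> ('w \<Rightarrow> 'z) \<Rightarrow> 'x set \<Rightarrow> ('z \<Rightarrow> 'x \<Rightarrow> ereal) \<Rightarrow> 'x \<Rightarrow> real" where
  "violation M \<Xi> \<xi> X f x = measure (law M \<Xi> \<xi>) {z\<in>\<Xi>. x \<notin> dom_at X f z}"

text \<open>The supremum is taken in \<^typ>\<open>ereal\<close>, so that it is \<open>-\<infinity>\<close> over an empty feasible region.\<close>

definition sup_violation_event ::
  "'w measure \<Rightarrow> 'z::topological_space set \<Rightarrow> ('w \<Rightarrow> 'z) \<Rightarrow> 'x set \<Rightarrow> ('z \<Rightarrow> 'x \<Rightarrow> ereal)
    \<Rightarrow> nat \<Rightarrow> real \<Rightarrow> (nat \<Rightarrow> 'z) set" where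
  "sup_violation_event M \<Xi> \<xi> X f N \<epsilon> =
     {s\<in>space (sample_law M \<Xi> \<xi> N).
        (SUP x\<in>saa_dom X f N s. ereal (violation M \<Xi> \<xi> X f x)) > ereal \<epsilon>}"

definition output_violation_event ::
  "'w measure \<Rightarrow> 'z::topological_space set \<Rightarrow> ('w \<Rightarrow> 'z) \<Rightarrow> 'x set \<Rightarrow> ('z \<Rightarrow> 'x \<Rightarrow> ereal)
    \<Rightarrow> nat \<Rightarrow> real \<Rightarrow> ((nat \<Rightarrow> 'z) \<Rightarrow> 'x) \<Rightarrow> (nat \<Rightarrow> 'z) set" where
  "output_violation_event M \<Xi> \<xi> X f N \<epsilon> xstar =
     {s\<in>space (sample_law M \<Xi> \<xi> N). violation M \<Xi> \<xi> X f (xstar s) > \<epsilon>}"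

end

theory Submission
  imports Defs
begin

text \<open>Call a sample \<open>s\<close> of size \<open>N\<close> bad if some \<open>x\<close> with \<open>V(x) > \<epsilon>\<close> is feasible for all of \<open>s\<close>. Draw a second
  sample \<open>t\<close> of size \<open>N\<close> and let \<open>W(s, t)\<close> be the supremum of \<open>2\<^sup>k\<close> over all \<open>x\<close> feasible for \<open>s\<close>, where
  \<open>k\<close> is the number of points of \<open>t\<close> at which \<open>x\<close> is infeasible. If \<open>s\<close> is bad, then the mean of \<open>W(s, t)\<close>
  over \<open>t\<close> is at least \<open>(1 + \<epsilon>)\<^sup>N\<close>. On the other hand, for each trace of the class on the \<open>2N\<close> points, the
  average over random swaps of \<open>s\<^sub>i\<close> and \<open>t\<^sub>i\<close> of the weight is at most \<open>1\<close>, and by the Sauer-Shelah lemma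
  there are at most \<open>\<Sum>i\<le>d. (2N choose i) \<le> (12 / \<epsilon>)\<^sup>d exp (\<epsilon> N / 6)\<close> traces. So the bad samples have
  probability at most \<open>(12 / \<epsilon>)\<^sup>d exp (\<epsilon> N / 6) (1 + \<epsilon>)\<^sup>-\<^sup>N\<close>, which is at most \<open>\<delta>\<close>. The exponential weights
  replace the usual threshold on \<open>k\<close>, which would lose too much for a bound with natural logarithms.

  The measurability of \<open>W\<close> is where the joint measurability of \<open>f\<close> enters. It follows from the measurable
  projection theorem along the Polish space of decisions. Without joint measurability the conclusion can
  fail: under the continuum hypothesis, take the initial segments of a well-order of type \<open>\<omega>\<^sub>1\<close> on the unit
  interval.\<close>

section \<open>Souslin sets and measurable projection\<close>

text \<open>The equation is oriented so that the simplifier cannot use it as a looping rewrite rule.\<close>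

definition locally_const :: "((nat \<Rightarrow> nat) \<Rightarrow> 'b) \<Rightarrow> bool" where
  "locally_const F \<longleftrightarrow> (\<forall>\<sigma>. \<exists>m. \<forall>\<tau>. (\<forall>i<m. \<tau> i = \<sigma> i) \<longrightarrow> F \<sigma> = F \<tau>)"

text \<open>Instead of indexing a Souslin scheme by finite sequences, the sets \<open>R n \<sigma>\<close> are indexed by
  infinite sequences \<open>\<sigma>\<close>, of which they may only use a finite (not uniformly bounded) initial segment.
  Reindexing then reduces to composition, without any bookkeeping of lengths.\<close>

definition souslin_scheme ::
  "'a set set \<Rightarrow> (nat \<Rightarrow> (nat \<Rightarrow> nat) \<Rightarrow> 'a set) \<Rightarrow> 'a set \<Rightarrow> bool" where
  "souslin_scheme \<R> R A \<longleftrightarrow> (\<forall>n \<sigma>. R n \<sigma> \<in> \<R>) \<and> (\<forall>n. locally_const (R n)) \<and>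
     A = {p. \<exists>\<sigma>. \<forall>n. p \<in> R n \<sigma>}"

definition souslin :: "'a set set \<Rightarrow> 'a set \<Rightarrow> bool" where
  "souslin \<R> A \<longleftrightarrow> (\<exists>R. souslin_scheme \<R> R A)"

lemma locally_constD:
  "locally_const F \<Longrightarrow> \<exists>m. \<forall>\<tau>. (\<forall>i<m. \<tau> i = \<sigma> i) \<longrightarrow> F \<sigma> = F \<tau>"
  by (simp only: locally_const_def)

lemma locally_constI:
  assumes "\<And>\<sigma>. \<exists>m. \<forall>\<tau>. (\<forall>i<m. \<tau> i = \<sigma> i) \<longrightarrow> F \<sigma> = F \<tau>"
  shows "locally_const F"
  using assms unfolding locally_const_def by (rule allI)

text \<open>\<open>F\<close> reads finitely many entries of \<open>g \<sigma>\<close>, and each of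
  these reads finitely many entries of \<open>\<sigma>\<close>; the sum of the bounds
  \<open>M i\<close> dominates all of them.\<close>

lemma locally_const_comp:
  assumes F: "locally_const F" and g: "\<And>i. locally_const (\<lambda>\<sigma>. g \<sigma> i)"
  shows "locally_const (\<lambda>\<sigma>. F (g \<sigma>))"
proof (rule locally_constI)
  fix \<sigma>
  obtain m where m: "\<forall>\<tau>. (\<forall>i<m. \<tau> i = g \<sigma> i) \<longrightarrow> F (g \<sigma>) = F \<tau>"
    using locally_constD[OF F] by (rule exE)
  have "\<exists>M. \<forall>\<tau>. (\<forall>j<M. \<tau> j = \<sigma> j) \<longrightarrow> g \<sigma> i = g \<tau> i" for i
    by (rule locally_constD[OF g])
  then obtain M where M: "\<And>i \<tau>. (\<forall>j<M i. \<tau> j = \<sigma> j) \<Longrightarrow> g \<sigma> i = g \<tau> i"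
    by metis
  have "F (g \<sigma>) = F (g \<tau>)" if \<tau>: "\<forall>j<(\<Sum>i<m. M i). \<tau> j = \<sigma> j" for \<tau>
  proof (intro m[rule_format] M[symmetric] allI impI)
    fix i j assume "i < m" "j < M i"
    moreover from \<open>i < m\<close> have "M i \<le> (\<Sum>i<m. M i)"
      by (intro member_le_sum) auto
    ultimately show "\<tau> j = \<sigma> j"
      using \<tau> by simp
  qed
  then show "\<exists>m. \<forall>\<tau>. (\<forall>i<m. \<tau> i = \<sigma> i) \<longrightarrow> F (g \<sigma>) = F (g \<tau>)"
    by (intro exI allI impI)
qed

lemma locally_const_proj: "locally_const (\<lambda>\<sigma>. h (\<sigma> i))"
  by (intro locally_constI exI[of _ "Suc i"]) simp

lemma locally_const_cases:
  assumes "\<And>k. locally_const (F k)"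
  shows "locally_const (\<lambda>\<sigma>. F (\<sigma> 0) (\<lambda>i. \<sigma> (Suc i)))"
proof (rule locally_constI)
  fix \<sigma> :: "nat \<Rightarrow> nat"
  obtain m where m: "\<forall>\<tau>. (\<forall>i<m. \<tau> i = \<sigma> (Suc i)) \<longrightarrow> F (\<sigma> 0) (\<lambda>i. \<sigma> (Suc i)) = F (\<sigma> 0) \<tau>"
    using locally_constD[OF assms] by (rule exE)
  have "F (\<sigma> 0) (\<lambda>i. \<sigma> (Suc i)) = F (\<tau> 0) (\<lambda>i. \<tau> (Suc i))" if "\<forall>i<Suc m. \<tau> i = \<sigma> i" for \<tau>
  proof -
    have "\<tau> 0 = \<sigma> 0"
      using that by simp
    moreover have "F (\<sigma> 0) (\<lambda>i. \<sigma> (Suc i)) = F (\<sigma> 0) (\<lambda>i. \<tau> (Suc i))"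
      using that by (intro m[rule_format]) simp
    ultimately show ?thesis
      by simp
  qed
  then show "\<exists>m. \<forall>\<tau>. (\<forall>i<m. \<tau> i = \<sigma> i) \<longrightarrow> F (\<sigma> 0) (\<lambda>i. \<sigma> (Suc i)) = F (\<tau> 0) (\<lambda>i. \<tau> (Suc i))"
    by (intro exI allI impI)
qed

lemma souslinI:
  fixes R :: "nat \<Rightarrow> (nat \<Rightarrow> nat) \<Rightarrow> 'a set"
  assumes "\<And>n \<sigma>. R n \<sigma> \<in> \<R>" "\<And>n. locally_const (R n)" "A = {p. \<exists>\<sigma>. \<forall>n. p \<in> R n \<sigma>}"
  shows "souslin \<R> A"
  unfolding souslin_def souslin_scheme_def by (intro exI[of _ R] conjI allI assms)

lemma souslinI_base: "A \<in> \<R> \<Longrightarrow> souslin \<R> A"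
  unfolding souslin_def souslin_scheme_def locally_const_def by (intro exI[of _ "\<lambda>_ _. A"]) auto

text \<open>Through the pairing of natural numbers, one sequence carries a witness for every
  \<open>A k\<close>, and one list of conditions runs through the conditions of all the
  schemes.\<close>

lemma souslin_INT:
  assumes "\<And>k::nat. souslin \<R> (A k)"
  shows "souslin \<R> (\<Inter>k. A k)"
proof -
  from assms obtain R where scheme: "\<And>k. souslin_scheme \<R> (R k) (A k)"
    unfolding souslin_def by metis
  have R: "R k n \<sigma> \<in> \<R>" "locally_const (R k n)"
    and A: "A k = {p. \<exists>\<sigma>. \<forall>n::nat. p \<in> R k n \<sigma>}" for k n \<sigma>
    using scheme[of k] unfolding souslin_scheme_def by blast+
  define S where "S n \<sigma> = (case prod_decode n of (k, j) \<Rightarrow> R k j (\<lambda>i. \<sigma> (prod_encode (k, i))))"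
    for n and \<sigma> :: "nat \<Rightarrow> nat"
  have "locally_const (S n)" for n
  proof -
    obtain k j where "prod_decode n = (k, j)"
      by fastforce
    then have "S n = (\<lambda>\<sigma>. R k j (\<lambda>i. \<sigma> (prod_encode (k, i))))"
      by (simp add: S_def fun_eq_iff)
    then show ?thesis
      using locally_const_comp[OF R(2)[of k j], of "\<lambda>\<sigma> i. \<sigma> (prod_encode (k, i))"]
        locally_const_proj[of "\<lambda>x. x"] by simp
  qed
  moreover have "(\<Inter>k. A k) = {p. \<exists>\<sigma>. \<forall>n. p \<in> S n \<sigma>}"
  proof safe
    fix p assume "p \<in> (\<Inter>k. A k)"
    then have "\<forall>k. \<exists>\<sigma>. \<forall>n. p \<in> R k n \<sigma>"
      by (auto simp: A)
    then obtain \<sigma> where \<sigma>: "\<And>k n. p \<in> R k n (\<sigma> k)"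
      by metis
    then show "\<exists>\<sigma>. \<forall>n. p \<in> S n \<sigma>"
      by (intro exI[of _ "\<lambda>n. case prod_decode n of (k, i) \<Rightarrow> \<sigma> k i"])
        (auto simp: S_def split: prod.split)
  next
    fix p \<sigma> k assume p: "\<forall>n. p \<in> S n \<sigma>"
    have "p \<in> R k j (\<lambda>i. \<sigma> (prod_encode (k, i)))" for j
      using p[rule_format, of "prod_encode (k, j)"] by (simp add: S_def)
    then show "p \<in> A k"
      by (auto simp: A)
  qed
  moreover have "S n \<sigma> \<in> \<R>" for n \<sigma>
    by (simp add: S_def R split: prod.split)
  ultimately show ?thesis
    by (intro souslinI[of S])
qed

text \<open>The first entry of the sequence names a member of the union, and the tail is a witness
  for that member.\<close>

lemma souslin_UN:
  assumes "\<And>k::nat. souslin \<R> (A k)"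
  shows "souslin \<R> (\<Union>k. A k)"
proof -
  from assms obtain R where scheme: "\<And>k. souslin_scheme \<R> (R k) (A k)"
    unfolding souslin_def by metis
  have R: "R k n \<sigma> \<in> \<R>" "locally_const (R k n)"
    and A: "A k = {p. \<exists>\<sigma>. \<forall>n::nat. p \<in> R k n \<sigma>}" for k n \<sigma>
    using scheme[of k] unfolding souslin_scheme_def by blast+
  define S where "S n \<sigma> = R (\<sigma> 0) n (\<lambda>i. \<sigma> (Suc i))" for n and \<sigma> :: "nat \<Rightarrow> nat"
  have "locally_const (S n)" for n
    unfolding S_def by (rule locally_const_cases[of "\<lambda>k. R k n"]) (rule R)
  moreover have "(\<Union>k. A k) = {p. \<exists>\<sigma>. \<forall>n. p \<in> S n \<sigma>}"
  proof safe
    fix p k assume "p \<in> A k"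
    then obtain \<sigma> where "\<And>n. p \<in> R k n \<sigma>"
      by (auto simp: A)
    then show "\<exists>\<sigma>. \<forall>n. p \<in> S n \<sigma>"
      by (intro exI[of _ "case_nat k \<sigma>"]) (auto simp: S_def)
  next
    fix p \<sigma> assume p: "\<forall>n. p \<in> S n \<sigma>"
    have "p \<in> A (\<sigma> 0)"
      unfolding A mem_Collect_eq
      using p[unfolded S_def] by (rule exI[of _ "\<lambda>i. \<sigma> (Suc i)"])
    then show "p \<in> (\<Union>k. A k)"
      by blast
  qed
  moreover have "S n \<sigma> \<in> \<R>" for n \<sigma>
    unfolding S_def by (rule R)
  ultimately show ?thesis
    by (intro souslinI[of S])
qed

lemma souslin_Un:
  assumes "souslin \<R> A" "souslin \<R> B"
  shows "souslin \<R> (A \<union> B)"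
proof -
  have "souslin \<R> (\<Union>k::nat. case_nat A (\<lambda>_. B) k)"
    using assms by (intro souslin_UN) (simp split: nat.split)
  also have "(\<Union>k::nat. case_nat A (\<lambda>_. B) k) = A \<union> B"
    by (auto split: nat.split nat.split_asm)
  finally show ?thesis .
qed

text \<open>Souslin sets need not be closed under complements, so the induction carries a set and
  its complement together. The step for countable unions then uses closure under unions and under
  intersections.\<close>

lemma souslin_sigma_sets:
  assumes A: "A \<in> sigma_sets \<Omega> \<R>" and \<Omega>: "\<Omega> \<in> \<R>" and empty: "{} \<in> \<R>"
    and sub: "\<And>R. R \<in> \<R> \<Longrightarrow> R \<subseteq> \<Omega>" and compl: "\<And>R. R \<in> \<R> \<Longrightarrow> souslin \<R> (\<Omega> - R)"
  shows "souslin \<R> A"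
proof -
  have \<R>: "\<R> \<subseteq> Pow \<Omega>"
    by (intro subsetI PowI sub)
  have "souslin \<R> A \<and> souslin \<R> (\<Omega> - A)"
    using A
  proof induction
    case (Basic a)
    then show ?case
      by (simp add: souslinI_base compl)
  next
    case Empty
    show ?case
      by (simp add: souslinI_base \<Omega> empty)
  next
    case (Compl a)
    then show ?case
      using sigma_sets_into_sp[OF \<R> Compl.hyps] by (simp add: double_diff)
  next
    case (Union a)
    have "souslin \<R> (\<Union>i. a i)"
      by (rule souslin_UN) (simp add: Union.IH)
    moreover have "souslin \<R> (\<Inter>i. \<Omega> - a i)"
      by (rule souslin_INT) (simp add: Union.IH)
    ultimately show ?case
      by simp
  qed
  then show ?thesis ..
qed

text \<open>The Lusin-Sierpinski argument: with a measurable hull \<open>E s\<close> for the part of \<open>A\<close> whose witnesses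
  extend the finite sequence \<open>s\<close>, the difference of \<open>E s\<close> and the union of the \<open>E (s @ [k])\<close> is null, and
  outside these countably many null sets one can extend sequences one entry at a time.\<close>

lemma (in finite_measure) complete_souslin_sets:
  assumes "complete_measure M" and A: "souslin (sets M) A"
  shows "A \<in> sets M"
proof -
  interpret complete_measure M by fact
  from A obtain R where R: "\<And>n \<sigma>. R n \<sigma> \<in> sets M" "\<And>n::nat. locally_const (R n)"
    and A_eq: "A = {p. \<exists>\<sigma>. \<forall>n. p \<in> R n \<sigma>}"
    unfolding souslin_def souslin_scheme_def by blast
  define agree where "agree \<sigma> s \<longleftrightarrow> (\<forall>i<length s. \<sigma> i = s ! i)" for \<sigma> and s :: "nat list"
  define ext where "ext s i = (if i < length s then s ! i else 0)" for s :: "nat list" and i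
  define A' where "A' s = {p. \<exists>\<sigma>. agree \<sigma> s \<and> (\<forall>n. p \<in> R n \<sigma>)}" for s
  have A'_space: "A' s \<subseteq> space M" for s
    using sets.sets_into_space[OF R(1)] by (auto simp: A'_def)
  have "\<exists>E\<subseteq>(\<Union>n::nat. space M). measurable_envelope M (A' s) E" for s
    using A'_space by (intro measurable_envelopeI_countable_cover) (auto simp: emeasure_eq_measure)
  then obtain H where H: "\<And>s. measurable_envelope M (A' s) (H s)"
    by metis
  \<comment> \<open>A finite sequence \<open>s\<close> imposes those conditions \<open>R n\<close>
    that it already determines; the others contribute \<open>space M\<close>. The zeros in
    \<open>ext\<close> pad \<open>s\<close> to a representative.\<close>
  define B where "B s = (\<Inter>n. if \<forall>\<tau>. agree \<tau> s \<longrightarrow> R n (ext s) = R n \<tau> then R n (ext s) else space M)" for s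
  have B: "B s \<in> sets M" for s
    unfolding B_def by (intro sets.countable_INT) (auto intro: R)
  have A'_B: "A' s \<subseteq> B s" for s
    using A'_space[of s] by (auto simp: A'_def B_def)
  define E where "E s = H s \<inter> B s" for s
  have E: "E s \<in> sets M" "A' s \<subseteq> E s" for s
    using measurable_envelopeD[OF H] B A'_B by (auto simp: E_def)
  define Z where "Z = (\<Union>s. E s - (\<Union>k. E (s @ [k])))"
  have "E s - (\<Union>k. E (s @ [k])) \<in> null_sets M" for s
  proof -
    have "A' s \<subseteq> (\<Union>k. A' (s @ [k]))"
      by (auto simp: A'_def agree_def less_Suc_eq nth_append)
    also have "\<dots> \<subseteq> (\<Union>k. E (s @ [k]))"
      using E by blast
    \<comment> \<open>A measurable subset of \<open>H s - A' s\<close> is null by the definition of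
      an envelope.\<close>
    finally have "E s - (\<Union>k. E (s @ [k])) \<subseteq> H s - A' s"
      by (auto simp: E_def)
    then show ?thesis
      using E by (intro null_setsI measurable_envelopeD1[OF H] sets.Diff sets.countable_UN) auto
  qed
  then have Z: "Z \<in> null_sets M"
    unfolding Z_def by (intro null_sets_UN') auto
  have "E [] - A \<subseteq> Z"
  proof safe
    fix p assume p: "p \<in> E []" "p \<notin> A"
    show "p \<in> Z"
    proof (rule ccontr)
      assume "p \<notin> Z"
      then have "\<forall>s. \<exists>k. p \<in> E s \<longrightarrow> p \<in> E (s @ [k])"
        by (auto simp: Z_def)
      then obtain k where k: "\<And>s. p \<in> E s \<Longrightarrow> p \<in> E (s @ [k s])"
        by metis
      \<comment> \<open>Iterating the extension builds a sequence \<open>\<sigma>\<close> whose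
        initial segments \<open>t n\<close> all satisfy \<open>p \<in> E (t n)\<close>.\<close>
      define t where "t = rec_nat [] (\<lambda>_ s. s @ [k s])"
      define \<sigma> where "\<sigma> n = k (t n)" for n
      have t: "t n = map \<sigma> [0..<n]" for n
        by (induction n) (auto simp: t_def \<sigma>_def)
      have pE: "p \<in> E (t n)" for n
        by (induction n) (auto simp: t_def p intro: k)
      have "p \<in> R n \<sigma>" for n
      proof -
        \<comment> \<open>By local constancy some initial segment \<open>t m\<close> determines
          \<open>R n \<sigma>\<close>, so this set is among those intersected in
          \<open>B (t m)\<close>.\<close>
        obtain m where m: "\<forall>\<tau>. (\<forall>i<m. \<tau> i = \<sigma> i) \<longrightarrow> R n \<sigma> = R n \<tau>"
          using locally_constD[OF R(2)] by (rule exE)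
        have *: "R n \<sigma> = R n (ext (t m))" "\<forall>\<tau>. agree \<tau> (t m) \<longrightarrow> R n \<sigma> = R n \<tau>"
          by (auto intro!: m[rule_format] simp: t ext_def agree_def)
        then have "\<forall>\<tau>. agree \<tau> (t m) \<longrightarrow> R n (ext (t m)) = R n \<tau>"
          by simp
        with pE[of m] have "p \<in> R n (ext (t m))"
          by (auto simp: E_def B_def dest!: spec[of _ n])
        with * show ?thesis
          by simp
      qed
      with p show False
        by (auto simp: A_eq)
    qed
  qed
  then have "E [] - A \<in> sets M"
    using Z by (rule complete)
  moreover have "A \<subseteq> E []"
    using E(2)[of "[]"] by (auto simp: A_eq A'_def agree_def)
  then have "A = E [] - (E [] - A)"
    by auto
  ultimately show ?thesis
    using E(1)[of "[]"] by (metis sets.Diff)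
qed

text \<open>The closed sets consist of the points at distance at least \<open>1 / (n + 1)\<close>
  from the complement. The whole space is treated apart, because \<open>infdist\<close> to the empty
  set is \<open>0\<close> by convention.\<close>

lemma open_countable_Union_closed:
  fixes U :: "'x::metric_space set"
  assumes "open U"
  obtains F :: "nat \<Rightarrow> 'x set" where "\<And>n. closed (F n)" "U = (\<Union>n. F n)"
proof (cases "U = UNIV")
  case True
  then show ?thesis
    by (intro that[of "\<lambda>_. UNIV"]) auto
next
  case False
  show ?thesis
  proof (rule that)
    show "closed {x. inverse (real (Suc n)) \<le> infdist x (- U)}" for n
      by (intro closed_Collect_le continuous_intros)
    show "U = (\<Union>n. {x. inverse (real (Suc n)) \<le> infdist x (- U)})"
    proof safe
      fix x assume "x \<in> U"
      then have "infdist x (- U) > 0"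
        using assms False by (intro infdist_pos_not_in_closed) auto
      then show "x \<in> (\<Union>n. {x. inverse (real (Suc n)) \<le> infdist x (- U)})"
        using reals_Archimedean by (auto intro: less_imp_le)
    next
      fix x n assume "inverse (real (Suc n)) \<le> infdist x (- U)"
      moreover have "0 < inverse (real (Suc n))"
        by simp
      ultimately have "infdist x (- U) \<noteq> 0"
        by linarith
      then show "x \<in> U"
        by (metis ComplI infdist_zero)
    qed
  qed
qed

text \<open>The complement of a generating rectangle is the union of
  \<open>(space P - E) \<times> UNIV\<close> and countably many rectangles, since the open set
  \<open>- C\<close> is a countable union of closed sets.\<close>

lemma souslin_pair_borel:
  fixes D :: "('a \<times> 'x::metric_space) set"
  assumes "D \<in> sets (P \<Otimes>\<^sub>M borel)"
  shows "souslin {E \<times> C |E C. E \<in> sets P \<and> closed C} D"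
proof -
  let ?R = "{E \<times> C |E C. E \<in> sets P \<and> closed (C::'x set)}"
  have R_sub: "?R \<subseteq> Pow (space P \<times> UNIV)"
    by (auto dest: sets.sets_into_space)
  have "sets (P \<Otimes>\<^sub>M (borel :: 'x measure)) =
      sets (sigma (space P \<times> space (borel :: 'x measure)) {a \<times> b |a b. a \<in> sets P \<and> b \<in> Collect closed})"
    by (rule sets_pair_eq[where Ca="{space P}" and Cb="{UNIV}"])
      (auto simp: sets.space_closed sets.sigma_sets_eq borel_eq_closed)
  then have "D \<in> sigma_sets (space P \<times> UNIV) ?R"
    using assms R_sub by simp
  then show ?thesis
  proof (rule souslin_sigma_sets)
    fix S assume "S \<in> ?R"
    then obtain E C where S: "S = E \<times> C" "E \<in> sets P" "closed C"
      by auto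
    obtain F :: "nat \<Rightarrow> 'x set" where F: "\<And>n. closed (F n)" "- C = (\<Union>n. F n)"
      using open_countable_Union_closed[of "- C"] S by auto
    have "space P \<times> UNIV - S = ((space P - E) \<times> UNIV) \<union> (\<Union>n. space P \<times> F n)"
      using S F(2) sets.sets_into_space[OF S(2)] by auto
    moreover have "souslin ?R ((space P - E) \<times> UNIV)"
      using S(2) by (intro souslinI_base) auto
    moreover have "souslin ?R (\<Union>n. space P \<times> F n)"
      using F(1) by (intro souslin_UN souslinI_base) auto
    ultimately show "souslin ?R (space P \<times> UNIV - S)"
      by (simp add: souslin_Un)
  next
    show "space P \<times> UNIV \<in> ?R"
      by auto
    show "{} \<in> ?R"
      by auto
  qed (use R_sub in auto)
qed

text \<open>A point of the fibre is coded by a fast Cauchy sequence in a countable dense set. Since the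
  sets \<open>c r\<close> are closed, membership of the limit is a countable conjunction of conditions on finitely
  many terms of the sequence.\<close>

lemma souslin_projection:
  fixes D :: "('a \<times> 'x::polish_space) set"
  assumes "D \<in> sets (P \<Otimes>\<^sub>M borel)"
  shows "souslin (sets P) {w. \<exists>x. (w, x) \<in> D}"
proof -
  let ?R = "{E \<times> C |E C. E \<in> sets P \<and> closed (C::'x set)}"
  obtain R where scheme: "souslin_scheme ?R R D"
    using souslin_pair_borel[OF assms] unfolding souslin_def by (rule exE)
  have R: "\<And>n \<sigma>. R n \<sigma> \<in> ?R" and R_lc: "\<And>n. locally_const (R n)"
    using scheme by (simp_all only: souslin_scheme_def)
  have D: "D = {p. \<exists>\<sigma>. \<forall>n. p \<in> R n \<sigma>}"
    using scheme by (simp only: souslin_scheme_def)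
  have "\<forall>r\<in>?R. \<exists>EC. fst EC \<in> sets P \<and> closed (snd EC) \<and> r = fst EC \<times> snd EC"
  proof
    fix r assume "r \<in> ?R"
    then obtain E C where "r = E \<times> C" "E \<in> sets P" "closed C"
      by blast
    then show "\<exists>EC. fst EC \<in> sets P \<and> closed (snd EC) \<and> r = fst EC \<times> snd EC"
      by (intro exI[of _ "(E, C)"]) simp
  qed
  from bchoice[OF this] obtain ec where
    ec: "\<forall>r\<in>?R. fst (ec r) \<in> sets P \<and> closed (snd (ec r)) \<and> r = fst (ec r) \<times> snd (ec r)"
    by (rule exE)
  define e where "e r = fst (ec r)" for r
  define c where "c r = snd (ec r)" for r
  have e: "e (R n \<sigma>) \<in> sets P" and c: "closed (c (R n \<sigma>))" for n \<sigma>
    using bspec[OF ec R[of n \<sigma>]] by (simp_all only: e_def c_def)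
  have mem_R: "(w, x) \<in> R n \<sigma> \<longleftrightarrow> w \<in> e (R n \<sigma>) \<and> x \<in> c (R n \<sigma>)" for n \<sigma> w x
  proof -
    have "R n \<sigma> = e (R n \<sigma>) \<times> c (R n \<sigma>)"
      using bspec[OF ec R[of n \<sigma>]] by (simp only: e_def c_def)
    then show ?thesis
      using mem_Times_iff[of "(w, x)" "e (R n \<sigma>)" "c (R n \<sigma>)"] by (simp only: fst_conv snd_conv)
  qed
  obtain Q :: "'x set" where Q: "countable Q" "\<And>U. open U \<Longrightarrow> U \<noteq> {} \<Longrightarrow> \<exists>d\<in>Q. d \<in> U"
    using countable_dense_setE by blast
  define q where "q = from_nat_into Q"
  have q: "\<exists>n. q n \<in> U" if "open U" "U \<noteq> {}" for U
    using Q(2)[OF that] from_nat_into_surj[OF Q(1)] unfolding q_def by metis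
  \<comment> \<open>These inequalities hold if \<open>q a\<close> and \<open>q b\<close> approximate
    a point of \<open>C\<close> with errors below \<open>(1/2)^k\<close> and
    \<open>(1/2)^(k+1)\<close>. Nonemptiness is demanded because \<open>infdist\<close> to the empty
    set is \<open>0\<close>.\<close>
  define good where "good C a b k \<longleftrightarrow> C \<noteq> {} \<and> dist (q a) (q b) \<le> 2 * (1/2)^k \<and> infdist (q a) C \<le> (1/2)^k"
    for C a b and k :: nat
  \<comment> \<open>Each entry of \<open>\<rho>\<close> codes a pair: an entry of the Souslin
    witness and the index of an approximating point. The number \<open>n\<close> codes a condition
    \<open>j\<close> together with an accuracy \<open>k\<close>.\<close>
  define S where "S n \<rho> = (case prod_decode n of (j, k) \<Rightarrow>
      let r = R j (\<lambda>i. fst (prod_decode (\<rho> i)))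
      in if good (c r) (snd (prod_decode (\<rho> k))) (snd (prod_decode (\<rho> (Suc k)))) k then e r else {})"
    for n and \<rho> :: "nat \<Rightarrow> nat"
  have "locally_const (S n)" for n
  proof -
    obtain j k where n: "prod_decode n = (j, k)"
      by fastforce
    have "\<exists>m. \<forall>\<tau>. (\<forall>i<m. \<tau> i = \<sigma> i) \<longrightarrow> S n \<sigma> = S n \<tau>" for \<sigma>
    proof -
      have "locally_const (\<lambda>\<rho>. R j (\<lambda>i. fst (prod_decode (\<rho> i))))"
        by (rule locally_const_comp[OF R_lc locally_const_proj])
      from locally_constD[OF this, of \<sigma>] obtain m where m: "\<forall>\<tau>. (\<forall>i<m. \<tau> i = \<sigma> i) \<longrightarrow>
          R j (\<lambda>i. fst (prod_decode (\<sigma> i))) = R j (\<lambda>i. fst (prod_decode (\<tau> i)))"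
        by (rule exE)
      \<comment> \<open>Besides the entries read by \<open>R j\<close>, the entries \<open>k\<close>
        and \<open>k + 1\<close> enter the approximation condition, hence
        \<open>Suc (Suc k)\<close>.\<close>
      have "S n \<sigma> = S n \<tau>" if \<tau>: "\<forall>i<max m (Suc (Suc k)). \<tau> i = \<sigma> i" for \<tau>
      proof -
        have "R j (\<lambda>i. fst (prod_decode (\<sigma> i))) = R j (\<lambda>i. fst (prod_decode (\<tau> i)))"
          by (rule m[rule_format]) (simp add: \<tau>)
        moreover have "\<tau> k = \<sigma> k" "\<tau> (Suc k) = \<sigma> (Suc k)"
          using \<tau> by auto
        ultimately show ?thesis
          by (simp only: S_def n prod.case)
      qed
      then show ?thesis
        by (intro exI allI impI)
    qed
    then show ?thesis
      by (rule locally_constI)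
  qed
  moreover have "S n \<rho> \<in> sets P" for n \<rho>
    by (simp add: S_def Let_def e split: prod.split)
  moreover have "{w. \<exists>x. (w, x) \<in> D} = {w. \<exists>\<rho>. \<forall>n. w \<in> S n \<rho>}"
  proof safe
    fix w x assume "(w, x) \<in> D"
    then obtain \<sigma> where \<sigma>: "\<And>n. (w, x) \<in> R n \<sigma>"
      by (auto simp: D)
    then have wx: "w \<in> e (R n \<sigma>)" "x \<in> c (R n \<sigma>)" for n
      by (simp_all add: mem_R)
    have "\<exists>n. q n \<in> ball x ((1/2)^k)" for k
    proof -
      have "x \<in> ball x ((1/2)^k)"
        by simp
      then show ?thesis
        using q[OF open_ball] by blast
    qed
    then obtain a where a: "\<And>k. dist x (q (a k)) < (1/2)^k"
      unfolding mem_ball by metis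
    have "good (c (R j \<sigma>)) (a k) (a (Suc k)) k" for j k
    proof -
      have "dist (q (a k)) (q (a (Suc k))) \<le> dist x (q (a k)) + dist x (q (a (Suc k)))"
        by (metis dist_commute dist_triangle)
      also have "\<dots> \<le> (1/2)^k + (1/2)^Suc k"
        using a by (intro add_mono less_imp_le)
      also have "\<dots> \<le> 2 * (1/2)^k"
        by simp
      finally show ?thesis
        using wx(2)[of j] infdist_le[OF wx(2), of "q (a k)" j] a[of k]
        by (auto simp: good_def dist_commute)
    qed
    then show "\<exists>\<rho>. \<forall>n. w \<in> S n \<rho>"
      using wx(1) by (intro exI[of _ "\<lambda>i. prod_encode (\<sigma> i, a i)"]) (auto simp: S_def split: prod.split)
  next
    fix w \<rho> assume w: "\<forall>n. w \<in> S n \<rho>"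
    define \<sigma> where "\<sigma> i = fst (prod_decode (\<rho> i))" for i
    define a where "a i = snd (prod_decode (\<rho> i))" for i
    have *: "good (c (R j \<sigma>)) (a k) (a (Suc k)) k \<and> w \<in> e (R j \<sigma>)" for j k
      using w[rule_format, of "prod_encode (j, k)"]
      by (simp add: S_def \<sigma>_def[abs_def] a_def Let_def split: if_splits)
    \<comment> \<open>The right-hand side is the sum of the bounds \<open>2 * (1/2)^i\<close> for
      \<open>k \<le> i < k + n\<close>.\<close>
    have dist_le: "dist (q (a k)) (q (a (k + n))) \<le> 4 * (1/2)^k - 4 * (1/2)^(k + n)" for k n
    proof (induction n)
      case (Suc n)
      have "dist (q (a k)) (q (a (k + Suc n))) \<le>
          dist (q (a k)) (q (a (k + n))) + dist (q (a (k + n))) (q (a (Suc (k + n))))"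
        by (simp add: dist_triangle)
      also have "dist (q (a (k + n))) (q (a (Suc (k + n)))) \<le> 2 * (1/2)^(k + n)"
        using *[of 0 "k + n"] by (simp add: good_def)
      finally show ?case
        using Suc by simp
    qed simp
    have "Cauchy (\<lambda>k. q (a k))"
      unfolding Cauchy_altdef2
    proof (intro allI impI)
      fix r :: real assume "r > 0"
      then obtain K where K: "(1/2)^K < r / 4"
        using real_arch_pow_inv[of "r / 4" "1/2"] by auto
      have "dist (q (a n)) (q (a K)) < r" if "n \<ge> K" for n
      proof -
        have "dist (q (a K)) (q (a n)) \<le> 4 * (1/2)^K - 4 * (1/2)^n"
          using dist_le[of K "n - K"] that by simp
        also have "\<dots> < r"
          using K zero_less_power[of "1/2::real" n] by linarith
        finally show ?thesis
          by (simp add: dist_commute)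
      qed
      then show "\<exists>N. \<forall>n\<ge>N. dist (q (a n)) (q (a N)) < r"
        by blast
    qed
    then obtain x where x: "(\<lambda>k. q (a k)) \<longlonglongrightarrow> x"
      using Cauchy_convergent convergent_def by blast
    have "x \<in> c (R j \<sigma>)" for j
    proof -
      have "(\<lambda>k. infdist (q (a k)) (c (R j \<sigma>))) \<longlonglongrightarrow> infdist x (c (R j \<sigma>))"
        by (intro tendsto_intros x)
      moreover have "(\<lambda>k. infdist (q (a k)) (c (R j \<sigma>))) \<longlonglongrightarrow> 0"
      proof (rule tendsto_sandwich)
        show "\<forall>\<^sub>F k in sequentially. 0 \<le> infdist (q (a k)) (c (R j \<sigma>))"
          by (simp add: infdist_nonneg)
        show "\<forall>\<^sub>F k in sequentially. infdist (q (a k)) (c (R j \<sigma>)) \<le> (1/2)^k"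
          using * by (simp add: good_def)
        show "(\<lambda>k. (1/2::real)^k) \<longlonglongrightarrow> 0"
          by (intro LIMSEQ_power_zero) auto
        show "(\<lambda>_. 0::real) \<longlonglongrightarrow> 0"
          by simp
      qed
      ultimately have "infdist x (c (R j \<sigma>)) = 0"
        by (rule LIMSEQ_unique)
      then show ?thesis
        using c[of j \<sigma>] *[of j] by (simp add: good_def in_closed_iff_infdist_zero)
    qed
    then have "(w, x) \<in> R j \<sigma>" for j
      using *[of j] by (simp add: mem_R)
    then show "\<exists>x. (w, x) \<in> D"
      by (auto simp: D)
  qed
  ultimately show ?thesis
    by (intro souslinI[of S])
qed

text \<open>The projection is Souslin over the measurable sets of the completion, and by
  completeness these are closed under the Souslin operation.\<close>

proposition (in finite_measure) measurable_projection:
  fixes D :: "('a \<times> 'x::polish_space) set"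
  assumes D: "D \<in> sets (M \<Otimes>\<^sub>M borel)"
  shows "{w. \<exists>x. (w, x) \<in> D} \<in> sets (completion M)"
proof -
  interpret C: finite_measure "completion M"
    by (rule finite_measureI) (simp add: emeasure_finite)
  have "sets (M \<Otimes>\<^sub>M (borel :: 'x measure)) \<subseteq> sets (completion M \<Otimes>\<^sub>M borel)"
    by (intro sets_pair_in_sets) auto
  with D show ?thesis
    by (intro C.complete_souslin_sets souslin_projection completion.complete_measure_axioms) auto
qed

section \<open>Shattering and traces\<close>

lemma shatters_alt: "shatters H S \<longleftrightarrow> finite S \<and> (\<forall>D\<subseteq>S. \<exists>C\<in>H. C \<inter> S = D)"
  unfolding shatters_def by (intro conj_cong refl all_cong imp_cong bex_cong) auto

lemma shattersD: "shatters H S \<Longrightarrow> D \<subseteq> S \<Longrightarrow> \<exists>C\<in>H. C \<inter> S = D"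
  by (simp add: shatters_alt)

text \<open>Pajor's strengthening of the Sauer-Shelah lemma, which is what the induction needs.\<close>

lemma card_le_card_shattered:
  assumes "finite A" "F \<subseteq> Pow A"
  shows "card F \<le> card {S \<in> Pow A. shatters F S}"
  using assms
proof (induction A arbitrary: F rule: finite_induct)
  case empty
  show ?case
  proof (cases "F = {}")
    case False
    with empty have "F = {{}}"
      by auto
    then have "{S \<in> Pow {}. shatters F S} = {{}}"
      by (auto simp: shatters_alt)
    with \<open>F = {{}}\<close> show ?thesis
      by simp
  qed simp
next
  case (insert a A)
  \<comment> \<open>\<open>F0 \<union> F1\<close> is the trace of \<open>F\<close> on
    \<open>A\<close>, and \<open>F0 \<inter> F1\<close> consists of the sets that occur in
    \<open>F\<close> both with and without \<open>a\<close>. Sets shattered by the former are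
    shattered by \<open>F\<close>; those shattered by the latter remain so after adding
    \<open>a\<close>.\<close>
  define F0 where "F0 = {C \<in> F. a \<notin> C}"
  define F1 where "F1 = {C. a \<notin> C \<and> insert a C \<in> F}"
  define Sh where "Sh F = {S \<in> Pow A. shatters F S}" for F
  have sub: "F0 \<subseteq> Pow A" "F1 \<subseteq> Pow A"
    using insert.prems insert.hyps by (auto simp: F0_def F1_def)
  have fin: "finite F0" "finite F1" "finite (Sh F)" for F
    using finite_subset[OF sub(1)] finite_subset[OF sub(2)] insert.hyps by (auto simp: Sh_def)
  have "F = F0 \<union> insert a ` F1"
  proof safe
    fix C assume "C \<in> F" "C \<notin> insert a ` F1"
    moreover have "C = insert a (C - {a})" if "a \<in> C"
      using that by auto
    ultimately show "C \<in> F0"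
      unfolding F0_def F1_def by (metis (mono_tags, lifting) Diff_iff image_eqI insertI1 mem_Collect_eq)
  qed (auto simp: F0_def F1_def)
  moreover have "F0 \<inter> insert a ` F1 = {}"
    by (auto simp: F0_def)
  moreover have "inj_on (insert a) F1"
    by (auto simp: inj_on_def F1_def)
  ultimately have "card F = card F0 + card F1"
    using fin by (simp add: card_Un_disjoint card_image)
  also have "\<dots> = card (F0 \<union> F1) + card (F0 \<inter> F1)"
    using fin by (intro card_Un_Int)
  also have "\<dots> \<le> card (Sh (F0 \<union> F1)) + card (Sh (F0 \<inter> F1))"
    unfolding Sh_def using sub by (intro add_mono insert.IH) auto
  also have "card (Sh (F0 \<inter> F1)) = card (insert a ` Sh (F0 \<inter> F1))"
    using insert.hyps by (intro card_image[symmetric]) (auto simp: inj_on_def Sh_def)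
  also have "card (Sh (F0 \<union> F1)) + \<dots> = card (Sh (F0 \<union> F1) \<union> insert a ` Sh (F0 \<inter> F1))"
    using insert.hyps fin by (intro card_Un_disjoint[symmetric]) (auto simp: Sh_def)
  also have "\<dots> \<le> card {S \<in> Pow (insert a A). shatters F S}"
  proof (intro card_mono Un_least)
    show "finite {S \<in> Pow (insert a A). shatters F S}"
      using insert.hyps by simp
    show "Sh (F0 \<union> F1) \<subseteq> {S \<in> Pow (insert a A). shatters F S}"
    proof
      fix S assume S: "S \<in> Sh (F0 \<union> F1)"
      then have "a \<notin> S"
        using insert.hyps by (auto simp: Sh_def)
      have "\<exists>C\<in>F. C \<inter> S = D" if "D \<subseteq> S" for D
      proof -
        have "\<exists>C\<in>F0 \<union> F1. C \<inter> S = D"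
          using S that by (intro shattersD) (simp_all add: Sh_def)
        then obtain C where C: "C \<in> F0 \<union> F1" "C \<inter> S = D"
          by (rule bexE)
        then have "C \<in> F \<or> insert a C \<in> F"
          by (auto simp: F0_def F1_def)
        moreover have "insert a C \<inter> S = D"
          using C \<open>a \<notin> S\<close> by auto
        ultimately show ?thesis
          using C(2) by (elim disjE) (rule bexI; assumption)+
      qed
      moreover have "S \<subseteq> A" "finite S"
        using S by (auto simp: Sh_def shatters_alt)
      ultimately show "S \<in> {S \<in> Pow (insert a A). shatters F S}"
        by (auto simp: shatters_alt)
    qed
    show "insert a ` Sh (F0 \<inter> F1) \<subseteq> {S \<in> Pow (insert a A). shatters F S}"
    proof (rule image_subsetI)
      fix S assume S: "S \<in> Sh (F0 \<inter> F1)"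
      have "\<exists>C\<in>F. C \<inter> insert a S = D" if "D \<subseteq> insert a S" for D
      proof -
        have "D - {a} \<subseteq> S"
          using that by auto
        then have "\<exists>C\<in>F0 \<inter> F1. C \<inter> S = D - {a}"
          using S by (intro shattersD) (simp_all add: Sh_def)
        then obtain C where C: "C \<in> F0 \<inter> F1" "C \<inter> S = D - {a}"
          by (rule bexE)
        then have CF: "C \<in> F" "insert a C \<in> F" "a \<notin> C"
          by (auto simp: F0_def F1_def)
        show ?thesis
        proof (cases "a \<in> D")
          case True
          then have "insert a C \<inter> insert a S = D"
            using C by auto
          with CF show ?thesis by blast
        next
          case False
          then have "C \<inter> insert a S = D"
            using C CF by auto
          with CF show ?thesis by blast
        qed
      qed
      moreover have "S \<subseteq> A" "finite S"
        using S by (auto simp: Sh_def shatters_alt)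
      ultimately show "insert a S \<in> {S \<in> Pow (insert a A). shatters F S}"
        by (auto simp: shatters_alt)
    qed
  qed
  finally show ?case .
qed

text \<open>By the previous bound it suffices to count the shattered subsets of \<open>A\<close>,
  which have at most \<open>d\<close> elements.\<close>

lemma sauer_shelah:
  assumes "finite A" "F \<subseteq> Pow A" and d: "\<And>S. S \<subseteq> A \<Longrightarrow> shatters F S \<Longrightarrow> card S \<le> d"
  shows "card F \<le> (\<Sum>i\<le>d. card A choose i)"
proof -
  have "card F \<le> card {S \<in> Pow A. shatters F S}"
    using assms(1,2) by (rule card_le_card_shattered)
  also have "\<dots> \<le> card (\<Union>i\<le>d. {S. S \<subseteq> A \<and> card S = i})"
    using d \<open>finite A\<close> by (intro card_mono) (auto intro: finite_subset[of _ "Pow A"])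
  also have "\<dots> \<le> (\<Sum>i\<le>d. card {S. S \<subseteq> A \<and> card S = i})"
    by (intro card_UN_le) simp
  also have "\<dots> = (\<Sum>i\<le>d. card A choose i)"
    using \<open>finite A\<close> by (simp add: n_subsets)
  finally show ?thesis .
qed

text \<open>The pattern \<open>{k}\<close> separates \<open>k\<close> from every other index, so two
  indices of the same point cannot both lie in \<open>S\<close>.\<close>

lemma shatters_image:
  assumes "finite S" and trace: "\<And>D. D \<subseteq> S \<Longrightarrow> \<exists>C\<in>H. \<forall>k\<in>S. z k \<in> C \<longleftrightarrow> k \<in> D"
  shows "inj_on z S" "shatters H (z ` S)"
proof -
  show "inj_on z S"
  proof (rule inj_onI)
    fix k l assume "k \<in> S" "l \<in> S" "z k = z l"
    then have "\<exists>C\<in>H. \<forall>m\<in>S. z m \<in> C \<longleftrightarrow> m \<in> {k}"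
      by (intro trace) simp
    then obtain C where C: "\<forall>m\<in>S. z m \<in> C \<longleftrightarrow> m \<in> {k}"
      by (rule bexE)
    then have "z k \<in> C"
      using \<open>k \<in> S\<close> by simp
    with C \<open>l \<in> S\<close> \<open>z k = z l\<close> show "k = l"
      by simp
  qed
  show "shatters H (z ` S)"
    unfolding shatters_alt
  proof (intro conjI allI impI)
    fix D assume D: "D \<subseteq> z ` S"
    have "\<exists>C\<in>H. \<forall>k\<in>S. z k \<in> C \<longleftrightarrow> k \<in> {k\<in>S. z k \<in> D}"
      by (intro trace) auto
    then obtain C where "C \<in> H" "\<forall>k\<in>S. z k \<in> C \<longleftrightarrow> k \<in> {k\<in>S. z k \<in> D}"
      by (rule bexE)
    then have "C \<inter> z ` S = D"
      using D by auto
    with \<open>C \<in> H\<close> show "\<exists>C\<in>H. C \<inter> z ` S = D"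
      by (rule bexI[rotated])
  qed (use \<open>finite S\<close> in simp)
qed

text \<open>Traces are taken as sets of indices, so that points of a sample may repeat; an index set
  on which all patterns occur is mapped injectively onto a shattered set of points.\<close>

lemma card_traces_le:
  assumes "finite A" "z ` A \<subseteq> \<Omega>"
    and vc: "\<And>K. K \<subseteq> \<Omega> \<Longrightarrow> shatters H K \<Longrightarrow> card K \<le> d"
  shows "card ((\<lambda>C. {k\<in>A. z k \<in> C}) ` H) \<le> (\<Sum>i\<le>d. card A choose i)"
proof (rule sauer_shelah)
  fix S assume S: "S \<subseteq> A" "shatters ((\<lambda>C. {k\<in>A. z k \<in> C}) ` H) S"
  have "finite S"
    using S assms finite_subset by blast
  moreover have "\<exists>C\<in>H. \<forall>k\<in>S. z k \<in> C \<longleftrightarrow> k \<in> D" if "D \<subseteq> S" for D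
    using shattersD[OF S(2) that] S(1) by auto
  ultimately have "inj_on z S" "shatters H (z ` S)"
    using shatters_image[of S H z] by simp_all
  moreover have "z ` S \<subseteq> \<Omega>"
    using S(1) assms(2) by auto
  ultimately show "card S \<le> d"
    using vc[of "z ` S"] by (simp add: card_image)
qed (use assms in auto)

section \<open>Symmetrization with a second sample\<close>

text \<open>For \<open>T \<subseteq> {1..N}\<close>, this permutes \<open>{1..2 * N}\<close> by
  exchanging partners in the two halves. Such a permutation preserves the product measure, which
  allows averaging over all \<open>T\<close>.\<close>

definition swap_indices :: "nat \<Rightarrow> nat set \<Rightarrow> nat \<Rightarrow> nat" where
  "swap_indices N T i = (if i \<in> T then i + N else if i > N \<and> i - N \<in> T then i - N else i)"

lemma swap_indices_involution: "T \<subseteq> {1..N} \<Longrightarrow> swap_indices N T (swap_indices N T i) = i"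
  by (auto simp: swap_indices_def)

lemma swap_indices_in: "T \<subseteq> {1..N} \<Longrightarrow> i \<in> {1..2 * N} \<Longrightarrow> swap_indices N T i \<in> {1..2 * N}"
  by (auto simp: swap_indices_def)

text \<open>The weight of a double sample, where \<open>b i\<close> says that point \<open>i\<close> is feasible: zero unless the first
  half is feasible, and otherwise doubled for each infeasible point of the second half. Weights sum well
  because swapping a pair with one infeasible point exchanges a factor \<open>0\<close> with a factor \<open>2\<close>.\<close>

definition ghost_weight :: "nat \<Rightarrow> (nat \<Rightarrow> bool) \<Rightarrow> ennreal" where
  "ghost_weight N b = (\<Prod>i=1..N. if b i then 1 else 0) * (\<Prod>i=1..N. if b (i + N) then 1 else 2)"

text \<open>The weight is a product over pairs, so the sum over \<open>T\<close> factors into sums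
  over the two orders of each pair: \<open>1 + 1\<close> if both points are feasible,
  \<open>0 + 2\<close> if one is, and \<open>0\<close> if none is.\<close>

lemma sum_ghost_weight_swap_le:
  "(\<Sum>T\<in>Pow {1..N}. ghost_weight N (\<lambda>i. b (swap_indices N T i))) \<le> 2 ^ N"
proof -
  define f :: "bool \<Rightarrow> bool \<Rightarrow> ennreal" where "f u v = (if u then 1 else 0) * (if v then 1 else 2)" for u v
  have "ghost_weight N (\<lambda>i. b (swap_indices N T i)) =
      (\<Prod>i\<in>T. f (b (i + N)) (b i)) * (\<Prod>i\<in>{1..N} - T. f (b i) (b (i + N)))" if T: "T \<subseteq> {1..N}" for T
  proof -
    have notin: "i + N \<notin> T" if "i \<in> {1..N}" for i
    proof
      assume "i + N \<in> T"
      then have "i + N \<in> {1..N}"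
        using T by (rule subsetD[rotated])
      with that show False
        by simp
    qed
    have "ghost_weight N (\<lambda>i. b (swap_indices N T i)) =
        (\<Prod>i=1..N. f (b (swap_indices N T i)) (b (swap_indices N T (i + N))))"
      by (simp add: ghost_weight_def f_def prod.distrib)
    also have "\<dots> = (\<Prod>i\<in>T. f (b (swap_indices N T i)) (b (swap_indices N T (i + N)))) *
        (\<Prod>i\<in>{1..N} - T. f (b (swap_indices N T i)) (b (swap_indices N T (i + N))))"
      using T by (subst prod.subset_diff[OF T]) (auto simp: mult.commute)
    also have "\<dots> = (\<Prod>i\<in>T. f (b (i + N)) (b i)) * (\<Prod>i\<in>{1..N} - T. f (b i) (b (i + N)))"
    proof (intro arg_cong2[where f="(*)"] prod.cong refl)
      fix i assume "i \<in> T"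
      moreover from this T have "i \<in> {1..N}"
        by (rule subsetD[rotated])
      moreover from this have "i + N \<notin> T"
        by (rule notin)
      ultimately show "f (b (swap_indices N T i)) (b (swap_indices N T (i + N))) = f (b (i + N)) (b i)"
        by (simp add: swap_indices_def)
    next
      fix i assume "i \<in> {1..N} - T"
      moreover from this have "i + N \<notin> T"
        by (intro notin) simp
      ultimately show "f (b (swap_indices N T i)) (b (swap_indices N T (i + N))) = f (b i) (b (i + N))"
        by (simp add: swap_indices_def)
    qed
    finally show ?thesis .
  qed
  then have "(\<Sum>T\<in>Pow {1..N}. ghost_weight N (\<lambda>i. b (swap_indices N T i))) =
      (\<Prod>i=1..N. f (b (i + N)) (b i) + f (b i) (b (i + N)))"
    by (simp add: prod_add)
  also have "\<dots> \<le> (\<Prod>i=1..N. 2)"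
    by (intro prod_mono_ennreal) (auto simp: f_def)
  finally show ?thesis
    by simp
qed

text \<open>The integral of the supremum \<open>W\<close> of the weights is bounded below by fixing the first half of the
  sample and above by averaging over all swaps. As a supremum over uncountably many \<open>x\<close>, \<open>W\<close> is
  only measurable up to null sets, by the projection theorem.\<close>

lemma (in prob_space) vc_symmetrization:
  fixes X :: "'x::polish_space set" and A :: "('a \<times> 'x) set" and N d :: nat and \<epsilon> :: real
  assumes X: "X \<in> sets borel" and A[measurable]: "A \<in> sets (M \<Otimes>\<^sub>M borel)"
    and S[measurable]: "S \<in> sets (Pi\<^sub>M {1..N} (\<lambda>_. M))" and "0 \<le> \<epsilon>"
    and bad: "\<And>s. s \<in> S \<Longrightarrow> \<exists>x\<in>X. (\<forall>i\<in>{1..N}. (s i, x) \<in> A) \<and> \<epsilon> \<le> prob {w \<in> space M. (w, x) \<notin> A}"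
    and vc: "\<And>K. K \<subseteq> space M \<Longrightarrow> shatters ((\<lambda>x. {w \<in> space M. (w, x) \<in> A}) ` X) K \<Longrightarrow> card K \<le> d"
  shows "emeasure (Pi\<^sub>M {1..N} (\<lambda>_. M)) S * ennreal ((1 + \<epsilon>) ^ N) \<le> ennreal (\<Sum>i\<le>d. real ((2 * N) choose i))"
proof -
  let ?I = "{1..N}" and ?J = "{1 + N..N + N}" and ?K = "{1..2 * N}"
  have IJ: "?I \<union> ?J = ?K" "?I \<inter> ?J = {}"
    by auto
  let ?P = "\<lambda>I. Pi\<^sub>M I (\<lambda>_::nat. M)"
  interpret PP: product_prob_space "\<lambda>_::nat. M"
    by (rule product_prob_spaceI) (rule prob_space_axioms)
  interpret I: prob_space "?P ?I"
    by (intro prob_space_PiM prob_space_axioms)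
  interpret J: prob_space "?P ?J"
    by (intro prob_space_PiM prob_space_axioms)
  interpret K: prob_space "?P ?K"
    by (intro prob_space_PiM prob_space_axioms)
  interpret PIJ: pair_sigma_finite "?P ?I" "?P ?J"
    by unfold_locales

  \<comment> \<open>Measurability of the supremum of the weights\<close>
  define W where "W z = (SUP x\<in>X. ghost_weight N (\<lambda>i. (z i, x) \<in> A))" for z :: "nat \<Rightarrow> 'a"
  have "W \<in> borel_measurable (completion (?P ?K))"
  proof (rule borel_measurableI_greater)
    fix a
    have pred: "Measurable.pred (?P ?K \<Otimes>\<^sub>M borel) (\<lambda>p. (fst p i, snd p) \<in> A)" if "i \<in> ?K" for i
      using that by measurable
    have weight: "(\<lambda>p. ghost_weight N (\<lambda>i. (fst p i, snd p) \<in> A)) \<in> borel_measurable (?P ?K \<Otimes>\<^sub>M borel)"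
      unfolding ghost_weight_def
      by (intro borel_measurable_times_ennreal borel_measurable_prod_ennreal measurable_If measurable_const pred) auto
    \<comment> \<open>The supremum exceeds \<open>a\<close> iff some weight does, which presents the
      set as a projection.\<close>
    have "{z \<in> space (completion (?P ?K)). a < W z} =
        {z. \<exists>x. (z, x) \<in> {p \<in> space (?P ?K \<Otimes>\<^sub>M borel).
          snd p \<in> X \<and> a < ghost_weight N (\<lambda>i. (fst p i, snd p) \<in> A)}}"
      by (auto simp: W_def less_SUP_iff space_pair_measure)
    also have "\<dots> \<in> sets (completion (?P ?K))"
    proof (rule K.measurable_projection)
      have "Measurable.pred (?P ?K \<Otimes>\<^sub>M borel) (\<lambda>p. a < ghost_weight N (\<lambda>i. (fst p i, snd p) \<in> A))"
        using weight by measurable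
      moreover have "Measurable.pred (?P ?K \<Otimes>\<^sub>M borel) (\<lambda>p. snd p \<in> X)"
        using X by measurable
      ultimately show "{p \<in> space (?P ?K \<Otimes>\<^sub>M borel).
          snd p \<in> X \<and> a < ghost_weight N (\<lambda>i. (fst p i, snd p) \<in> A)} \<in> sets (?P ?K \<Otimes>\<^sub>M borel)"
        by measurable
    qed
    finally show "{z \<in> space (completion (?P ?K)). a < W z} \<in> sets (completion (?P ?K))" .
  qed
  \<comment> \<open>Iterated integrals and changes of variables are taken on the uncompleted
    product, so \<open>W\<close> is replaced by a measurable version.\<close>
  then obtain W' where W'[measurable]: "W' \<in> borel_measurable (?P ?K)" and WW': "AE z in ?P ?K. W z = W' z"
    using completion_ex_borel_measurable by blast

  \<comment> \<open>Lower bound with the first sample fixed\<close>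
  have "emeasure (?P ?I) S * ennreal ((1 + \<epsilon>) ^ N) = (\<integral>\<^sup>+ s. ennreal ((1 + \<epsilon>) ^ N) * indicator S s \<partial>?P ?I)"
    by (subst nn_integral_cmult_indicator[OF S]) (rule mult.commute)
  also have "\<dots> \<le> (\<integral>\<^sup>+ s. \<integral>\<^sup>+ t. W' (merge ?I ?J (s, t)) \<partial>?P ?J \<partial>?P ?I)"
  proof (rule nn_integral_mono_AE)
    note fin = finite_atLeastAtMost[of 1 N] finite_atLeastAtMost[of "1 + N" "N + N"]
    have "AE p in distr (?P ?I \<Otimes>\<^sub>M ?P ?J) (?P ?K) (merge ?I ?J). W p = W' p"
      using WW' by (simp only: PP.distr_merge[OF IJ(2) fin, unfolded IJ(1)])
    then have "AE p in ?P ?I \<Otimes>\<^sub>M ?P ?J. W (merge ?I ?J p) = W' (merge ?I ?J p)"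
      by (rule AE_distrD[OF measurable_merge[of ?I ?J "\<lambda>_. M", unfolded IJ(1)]])
    then have "AE s in ?P ?I. AE t in ?P ?J. W (merge ?I ?J (s, t)) = W' (merge ?I ?J (s, t))"
      by (rule PIJ.AE_pair)
    then show "AE s in ?P ?I. ennreal ((1 + \<epsilon>) ^ N) * indicator S s \<le> (\<integral>\<^sup>+ t. W' (merge ?I ?J (s, t)) \<partial>?P ?J)"
    proof eventually_elim
      case (elim s)
      show ?case
      proof (cases "s \<in> S")
        case True
        then obtain x where x: "x \<in> X" "\<And>i. i \<in> ?I \<Longrightarrow> (s i, x) \<in> A" "\<epsilon> \<le> prob {w \<in> space M. (w, x) \<notin> A}"
          using bad by blast
        define B where "B = {w \<in> space M. (w, x) \<notin> A}"
        have B[measurable, simp]: "B \<in> sets M"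
          unfolding B_def by measurable
        \<comment> \<open>A fresh point contributes the factor \<open>2\<close> with probability
          \<open>prob B\<close> and \<open>1\<close> otherwise, with mean \<open>1 + prob B\<close>.
          Independence of the \<open>N\<close> fresh points then yields the power.\<close>
        have "ennreal (1 + \<epsilon>) = 1 + ennreal \<epsilon>"
          using \<open>0 \<le> \<epsilon>\<close> by simp
        also have "\<dots> \<le> 1 + ennreal (prob B)"
          using x(3) by (intro add_left_mono ennreal_leI) (simp add: B_def)
        also have "\<dots> = (\<integral>\<^sup>+ w. 1 + indicator B w \<partial>M)"
          by (subst nn_integral_add) (simp_all add: prob_space emeasure_eq_measure)
        also have "\<dots> = (\<integral>\<^sup>+ w. (if (w, x) \<in> A then 1 else 2) \<partial>M)"
          by (intro nn_integral_cong) (auto simp: B_def indicator_def)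
        finally have fail: "ennreal (1 + \<epsilon>) \<le> (\<integral>\<^sup>+ w. (if (w, x) \<in> A then 1 else 2) \<partial>M)" .
        have "ennreal ((1 + \<epsilon>) ^ N) = (\<Prod>j\<in>?J. ennreal (1 + \<epsilon>))"
          using \<open>0 \<le> \<epsilon>\<close> by (simp add: ennreal_power del: ennreal_plus)
        also have "\<dots> \<le> (\<Prod>j\<in>?J. \<integral>\<^sup>+ w. (if (w, x) \<in> A then 1 else 2) \<partial>M)"
          using fail by (intro prod_mono_ennreal)
        also have "\<dots> = (\<integral>\<^sup>+ t. (\<Prod>j\<in>?J. if (t j, x) \<in> A then 1 else 2) \<partial>?P ?J)"
          by (intro PP.product_nn_integral_prod[symmetric]) auto
        also have "\<dots> \<le> (\<integral>\<^sup>+ t. W (merge ?I ?J (s, t)) \<partial>?P ?J)"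
        proof (rule nn_integral_mono)
          fix t
          have "(\<Prod>j\<in>?J. if (t j, x) \<in> A then 1 else 2 :: ennreal) =
              (\<Prod>i\<in>?I. if (t (i + N), x) \<in> A then 1 else 2)"
            by (rule prod.shift_bounds_cl_nat_ivl)
          \<comment> \<open>The factor of the first half is \<open>1\<close>, since \<open>x\<close>
            is feasible for all of \<open>s\<close>.\<close>
          also have "\<dots> = ghost_weight N (\<lambda>i. (merge ?I ?J (s, t) i, x) \<in> A)"
            using x(2) by (simp add: ghost_weight_def merge_def)
          also have "\<dots> \<le> W (merge ?I ?J (s, t))"
            unfolding W_def using x(1) by (rule SUP_upper)
          finally show "(\<Prod>j\<in>?J. if (t j, x) \<in> A then 1 else 2) \<le> W (merge ?I ?J (s, t))" .
        qed
        also have "\<dots> = (\<integral>\<^sup>+ t. W' (merge ?I ?J (s, t)) \<partial>?P ?J)"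
          using elim by (rule nn_integral_cong_AE)
        finally show ?thesis
          using True by simp
      qed simp
    qed
  qed
  also have "\<dots> = (\<integral>\<^sup>+ z. W' z \<partial>?P ?K)"
    by (rule PP.product_nn_integral_fold[OF IJ(2) finite_atLeastAtMost finite_atLeastAtMost,
          unfolded IJ(1), OF W', symmetric])
  finally have lower: "emeasure (?P ?I) S * ennreal ((1 + \<epsilon>) ^ N) \<le> (\<integral>\<^sup>+ z. W' z \<partial>?P ?K)" .

  \<comment> \<open>Upper bound by averaging over swaps\<close>
  let ?swap = "\<lambda>T z. \<lambda>i\<in>?K. z (swap_indices N T i)"
  have distr_swap: "distr (?P ?K) (?P ?K) (?swap T) = ?P ?K" and
    meas_swap: "?swap T \<in> measurable (?P ?K) (?P ?K)" if T: "T \<subseteq> ?I" for T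
  proof -
    have "inj_on (swap_indices N T) ?K"
      using swap_indices_involution[OF T] by (rule inj_on_inverseI)
    then show "distr (?P ?K) (?P ?K) (?swap T) = ?P ?K"
      using swap_indices_in[OF T] prob_space_axioms
      by (intro distr_PiM_reindex[where M="\<lambda>_. M"]) auto
    show "?swap T \<in> measurable (?P ?K) (?P ?K)"
      using swap_indices_in[OF T] by (intro measurable_restrict measurable_component_singleton)
  qed
  have "2 ^ N * (\<integral>\<^sup>+ z. W' z \<partial>?P ?K) = (\<Sum>T\<in>Pow ?I. \<integral>\<^sup>+ z. W' z \<partial>?P ?K)"
    by (simp add: card_Pow)
  also have "\<dots> = (\<Sum>T\<in>Pow ?I. \<integral>\<^sup>+ z. W' (?swap T z) \<partial>?P ?K)"
  proof (rule sum.cong)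
    fix T assume "T \<in> Pow ?I"
    then have T: "T \<subseteq> ?I"
      by simp
    have "(\<integral>\<^sup>+ z. W' z \<partial>?P ?K) = (\<integral>\<^sup>+ z. W' z \<partial>distr (?P ?K) (?P ?K) (?swap T))"
      by (simp only: distr_swap[OF T])
    also have "\<dots> = (\<integral>\<^sup>+ z. W' (?swap T z) \<partial>?P ?K)"
      by (rule nn_integral_distr[OF meas_swap[OF T]]) (simp only: distr_swap[OF T] W')
    finally show "(\<integral>\<^sup>+ z. W' z \<partial>?P ?K) = (\<integral>\<^sup>+ z. W' (?swap T z) \<partial>?P ?K)" .
  qed simp
  also have "\<dots> = (\<integral>\<^sup>+ z. (\<Sum>T\<in>Pow ?I. W' (?swap T z)) \<partial>?P ?K)"
    by (intro nn_integral_sum[symmetric] measurable_compose[OF meas_swap W']) simp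
  also have "\<dots> \<le> (\<integral>\<^sup>+ z. 2 ^ N * of_nat (\<Sum>i\<le>d. (2 * N) choose i) \<partial>?P ?K)"
  proof (rule nn_integral_mono_AE)
    \<comment> \<open>There are finitely many swaps and each preserves the measure, so one null set
      serves all of them.\<close>
    have "AE z in ?P ?K. \<forall>T\<in>Pow ?I. W (?swap T z) = W' (?swap T z)"
    proof (intro AE_finite_allI)
      fix T assume "T \<in> Pow ?I"
      then have T: "T \<subseteq> ?I"
        by simp
      have "AE z in distr (?P ?K) (?P ?K) (?swap T). W z = W' z"
        using WW' by (simp only: distr_swap[OF T])
      then show "AE z in ?P ?K. W (?swap T z) = W' (?swap T z)"
        by (rule AE_distrD[OF meas_swap[OF T]])
    qed simp
    with AE_space show "AE z in ?P ?K. (\<Sum>T\<in>Pow ?I. W' (?swap T z)) \<le> 2 ^ N * of_nat (\<Sum>i\<le>d. (2 * N) choose i)"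
    proof eventually_elim
      case (elim z)
      define \<C> where "\<C> = (\<lambda>C. {k\<in>?K. z k \<in> C}) ` ((\<lambda>x. {w \<in> space M. (w, x) \<in> A}) ` X)"
      have "z ` ?K \<subseteq> space M"
        using elim(1) by (auto simp: space_PiM)
      have "card \<C> \<le> (\<Sum>i\<le>d. card ?K choose i)"
        unfolding \<C>_def
      proof (rule card_traces_le)
        show "finite ?K"
          by simp
        show "z ` ?K \<subseteq> space M"
          by fact
      next
        fix L assume "L \<subseteq> space M" "shatters ((\<lambda>x. {w \<in> space M. (w, x) \<in> A}) ` X) L"
        then show "card L \<le> d"
          by (rule vc)
      qed
      then have card_\<C>: "card \<C> \<le> (\<Sum>i\<le>d. (2 * N) choose i)"
        by simp
      have fin: "finite \<C>"
        by (rule finite_subset[of _ "Pow ?K"], unfold \<C>_def) (rule image_subsetI, auto)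
      define v where "v T C = ghost_weight N (\<lambda>i. swap_indices N T i \<in> C)" for T C
      \<comment> \<open>The weight depends on \<open>x\<close> through its trace alone, so the
        supremum over \<open>X\<close> is at most the sum over the finitely many traces.\<close>
      have W_le: "W (?swap T z) \<le> (\<Sum>C\<in>\<C>. v T C)" if T: "T \<subseteq> ?I" for T
        unfolding W_def
      proof (rule SUP_least)
        fix x assume "x \<in> X"
        define C where "C = {k\<in>?K. z k \<in> {w \<in> space M. (w, x) \<in> A}}"
        have "C \<in> \<C>"
          unfolding \<C>_def C_def using \<open>x \<in> X\<close> by (intro imageI)
        have "(?swap T z i, x) \<in> A \<longleftrightarrow> swap_indices N T i \<in> C" if "i \<in> ?K" for i
          using swap_indices_in[OF T that] that \<open>z ` ?K \<subseteq> space M\<close> by (auto simp: C_def)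
        then have "ghost_weight N (\<lambda>i. (?swap T z i, x) \<in> A) = v T C"
          unfolding v_def ghost_weight_def by (intro arg_cong2[where f="(*)"] prod.cong) auto
        also have "\<dots> \<le> (\<Sum>C\<in>\<C>. v T C)"
          using fin \<open>C \<in> \<C>\<close> by (intro member_le_sum) auto
        finally show "ghost_weight N (\<lambda>i. (?swap T z i, x) \<in> A) \<le> (\<Sum>C\<in>\<C>. v T C)" .
      qed
      have "(\<Sum>T\<in>Pow ?I. W' (?swap T z)) = (\<Sum>T\<in>Pow ?I. W (?swap T z))"
        using elim(2) by (intro sum.cong) auto
      also have "\<dots> \<le> (\<Sum>T\<in>Pow ?I. \<Sum>C\<in>\<C>. v T C)"
        using W_le by (intro sum_mono) auto
      also have "\<dots> = (\<Sum>C\<in>\<C>. \<Sum>T\<in>Pow ?I. v T C)"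
        by (rule sum.swap)
      also have "\<dots> \<le> (\<Sum>C\<in>\<C>. 2 ^ N)"
        unfolding v_def by (intro sum_mono sum_ghost_weight_swap_le)
      also have "\<dots> = 2 ^ N * of_nat (card \<C>)"
        by (simp add: mult.commute)
      also have "\<dots> \<le> 2 ^ N * of_nat (\<Sum>i\<le>d. (2 * N) choose i)"
        using card_\<C> by (intro mult_left_mono of_nat_mono) auto
      finally show ?case .
    qed
  qed
  also have "\<dots> = 2 ^ N * of_nat (\<Sum>i\<le>d. (2 * N) choose i)"
    using K.emeasure_space_1 by simp
  finally have "(\<integral>\<^sup>+ z. W' z \<partial>?P ?K) \<le> of_nat (\<Sum>i\<le>d. (2 * N) choose i)"
    by (subst (asm) ennreal_mult_le_mult_iff) (simp_all add: power_eq_top_ennreal)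
  also have "\<dots> = ennreal (\<Sum>i\<le>d. real ((2 * N) choose i))"
    by (subst ennreal_of_nat_eq_real_of_nat) simp
  finally show ?thesis
    using lower by (rule order_trans[rotated])
qed

section \<open>The sample size\<close>

text \<open>For \<open>i \<le> d\<close> the factor \<open>y ^ i\<close> is at least
  \<open>y ^ d\<close>, which brings in the binomial theorem and
  \<open>1 + y \<le> exp y\<close>.\<close>

lemma sum_binomial_le_exp:
  fixes y :: real
  assumes "0 < y" "y \<le> 1"
  shows "(\<Sum>i\<le>d. real (n choose i)) \<le> (1 / y) ^ d * exp (real n * y)"
proof -
  have "y ^ d * (\<Sum>i\<le>d. real (n choose i)) \<le> (\<Sum>i\<le>d. real (n choose i) * y ^ i)"
    unfolding sum_distrib_left using assms
    by (intro sum_mono) (simp add: mult.commute[of _ "y ^ _"] mult_right_mono power_decreasing)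
  \<comment> \<open>As \<open>d\<close> may exceed \<open>n\<close>, the sum is first extended to
    \<open>max d n\<close>; its terms beyond \<open>n\<close> vanish.\<close>
  also have "\<dots> \<le> (\<Sum>i\<le>max d n. real (n choose i) * y ^ i)"
    using assms by (intro sum_mono2) auto
  also have "\<dots> = (\<Sum>i\<le>n. real (n choose i) * y ^ i)"
    by (intro sum.mono_neutral_right) (auto simp: binomial_eq_0)
  also have "\<dots> = (y + 1) ^ n"
    by (simp add: binomial_ring)
  also have "\<dots> \<le> exp y ^ n"
    using assms exp_ge_add_one_self[of y] by (intro power_mono) (auto simp: add.commute)
  also have "\<dots> = exp (real n * y)"
    by (rule exp_of_nat_mult[symmetric])
  finally show ?thesis
    using assms by (simp add: field_simps power_divide)
qed

text \<open>The choice \<open>y = \<epsilon> / 12\<close> in the previous bound produces the constant \<open>12 / \<epsilon>\<close>.\<close>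

lemma sample_size_bound:
  fixes \<epsilon> \<delta> :: real and N d :: nat
  assumes "0 < \<delta>" "0 < \<epsilon>" "\<epsilon> \<le> 1"
    and N: "real N \<ge> 4 / \<epsilon> * (real d * ln (12 / \<epsilon>) + ln (2 / \<delta>))"
    and pos: "real d * ln (12 / \<epsilon>) + ln (2 / \<delta>) \<ge> 0"
  shows "(\<Sum>i\<le>d. real ((2 * N) choose i)) \<le> \<delta> * (1 + \<epsilon>) ^ N"
proof -
  define L where "L = real d * ln (12 / \<epsilon>)"
  have L: "(12 / \<epsilon>) ^ d = exp L"
    using assms by (simp add: L_def exp_of_nat_mult)
  \<comment> \<open>The quadratic bound on the exponential gives
    \<open>exp (\<epsilon> / 2) \<le> 1 + \<epsilon>\<close>.\<close>
  have "exp (\<epsilon> / 2) \<le> 1 + \<epsilon> / 2 + (\<epsilon> / 2)\<^sup>2"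
    using assms by (intro exp_bound) auto
  also have "(\<epsilon> / 2)\<^sup>2 \<le> \<epsilon> / 2"
    using assms mult_left_mono[of "\<epsilon> / 2" 1 "\<epsilon> / 2"] by (simp add: power2_eq_square)
  also have "1 + \<epsilon> / 2 + \<epsilon> / 2 = 1 + \<epsilon>"
    by simp
  finally have "exp (real N * (\<epsilon> / 2)) \<le> (1 + \<epsilon>) ^ N"
    unfolding exp_of_nat_mult by (intro power_mono) auto
  define P where "P = real N * \<epsilon>"
  have "4 * (L + ln (2 / \<delta>)) \<le> P"
    using N assms by (simp add: field_simps L_def P_def)
  moreover have "ln (2 / \<delta>) \<ge> - ln \<delta>"
    using assms by (simp add: ln_div)
  moreover define l where "l = ln (2 / \<delta>)"
  ultimately have "4 * (L + l) \<le> P" "- ln \<delta> \<le> l" "0 \<le> L + l"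
    using pos by (simp_all add: L_def)
  \<comment> \<open>The claim is \<open>L - ln \<delta> \<le> P / 3\<close>. It follows from
    \<open>L - ln \<delta> \<le> L + l \<le> P / 4\<close>, where \<open>0 \<le> L + l\<close> makes
    \<open>P\<close> nonnegative.\<close>
  then have "L + P / 6 \<le> ln \<delta> + P / 2"
    by argo
  then have *: "L + real (2 * N) * (\<epsilon> / 12) \<le> ln \<delta> + real N * (\<epsilon> / 2)"
    by (simp add: P_def mult.commute)
  have "(\<Sum>i\<le>d. real ((2 * N) choose i)) \<le> (1 / (\<epsilon> / 12)) ^ d * exp (real (2 * N) * (\<epsilon> / 12))"
    using assms by (intro sum_binomial_le_exp) auto
  also have "\<dots> = exp (L + real (2 * N) * (\<epsilon> / 12))"
    using L by (simp add: exp_add)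
  also have "\<dots> \<le> exp (ln \<delta> + real N * (\<epsilon> / 2))"
    using * by simp
  also have "\<dots> = \<delta> * exp (real N * (\<epsilon> / 2))"
    using assms by (simp add: exp_add)
  also have "\<dots> \<le> \<delta> * (1 + \<epsilon>) ^ N"
    using assms \<open>exp (real N * (\<epsilon> / 2)) \<le> (1 + \<epsilon>) ^ N\<close> by (intro mult_left_mono) auto
  finally show ?thesis .
qed

section \<open>Completions and the main theorem\<close>

lemma card_le_vc_dim:
  assumes "vc_dim H = enat d" "shatters H S"
  shows "card S \<le> d"
proof -
  have "enat (card S) \<le> vc_dim H"
    unfolding vc_dim_def using assms(2) by (intro SUP_upper) simp
  then show ?thesis
    by (simp add: assms(1))
qed

text \<open>Agreement off a cylinder over a null set holds for the generators and survives
  complements and countable unions, for which the exceptional null sets are united.\<close>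

lemma prod_completion_mod_null:
  assumes "E \<in> sets (prod_completion M B)"
  obtains Z E' where "Z \<in> null_sets M" "E' \<in> sets (M \<Otimes>\<^sub>M B)"
    "\<And>w x. w \<in> space M \<Longrightarrow> x \<in> space B \<Longrightarrow> w \<notin> Z \<Longrightarrow> (w, x) \<in> E \<longleftrightarrow> (w, x) \<in> E'"
proof -
  let ?G = "sets (M \<Otimes>\<^sub>M B) \<union> {E. \<exists>Z\<in>null_sets M. E \<subseteq> Z \<times> space B}"
  define agree where
    "agree Z E E' \<longleftrightarrow> (\<forall>w\<in>space M - Z. \<forall>x\<in>space B. (w, x) \<in> E \<longleftrightarrow> (w, x) \<in> E')" for Z E E'
  have "?G \<subseteq> Pow (space M \<times> space B)"
  proof (rule Un_least)
    show "sets (M \<Otimes>\<^sub>M B) \<subseteq> Pow (space M \<times> space B)"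
      using sets.space_closed[of "M \<Otimes>\<^sub>M B"] by (simp add: space_pair_measure)
    show "{E. \<exists>Z\<in>null_sets M. E \<subseteq> Z \<times> space B} \<subseteq> Pow (space M \<times> space B)"
      using sets.sets_into_space[OF null_setsD2] by blast
  qed
  then have "E \<in> sigma_sets (space M \<times> space B) ?G"
    using assms unfolding prod_completion_def by simp
  then have "\<exists>Z E'. Z \<in> null_sets M \<and> E' \<in> sets (M \<Otimes>\<^sub>M B) \<and> agree Z E E'"
  proof induction
    case (Basic E)
    then show ?case
    proof
      assume "E \<in> sets (M \<Otimes>\<^sub>M B)"
      moreover have "agree {} E E"
        by (simp add: agree_def)
      ultimately show ?thesis
        by blast
    next
      assume "E \<in> {E. \<exists>Z\<in>null_sets M. E \<subseteq> Z \<times> space B}"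
      then obtain Z where "Z \<in> null_sets M" "E \<subseteq> Z \<times> space B"
        by blast
      moreover from this have "agree Z E {}"
        by (auto simp: agree_def)
      ultimately show ?thesis
        by blast
    qed
  next
    case Empty
    have "agree {} {} {}"
      by (simp add: agree_def)
    then show ?case
      by blast
  next
    case (Compl E)
    then obtain Z E' where "Z \<in> null_sets M" "E' \<in> sets (M \<Otimes>\<^sub>M B)" "agree Z E E'"
      by blast
    moreover from this have "agree Z (space M \<times> space B - E) (space (M \<Otimes>\<^sub>M B) - E')"
      by (simp add: agree_def space_pair_measure)
    ultimately show ?case
      by blast
  next
    case (Union E)
    from Union.IH obtain Z E' where *: "\<And>i. Z i \<in> null_sets M" "\<And>i. E' i \<in> sets (M \<Otimes>\<^sub>M B)"
      "\<And>i. agree (Z i) (E i) (E' i)"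
      by metis
    have "(\<Union>i. Z i) \<in> null_sets M" "(\<Union>i. E' i) \<in> sets (M \<Otimes>\<^sub>M B)"
      using * by auto
    moreover have "agree (\<Union>i. Z i) (\<Union>i. E i) (\<Union>i. E' i)"
      using *(3) by (simp add: agree_def)
    ultimately show ?case
      by blast
  qed
  then show thesis
    using that unfolding agree_def by blast
qed

text \<open>By completeness of \<open>M\<close>, preimages of subsets of null sets are measurable,
  so \<open>\<xi>\<close> stays measurable when its law is completed.\<close>

lemma law_eq_distr:
  assumes "complete_measure M" "\<xi> \<in> borel_measurable M" "\<xi> \<in> space M \<rightarrow> \<Xi>"
  shows "\<xi> \<in> measurable M (law M \<Xi> \<xi>)" "distr M (law M \<Xi> \<xi>) \<xi> = law M \<Xi> \<xi>"
proof -
  interpret complete_measure M by fact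
  let ?L = "distr M (restrict_space borel \<Xi>) \<xi>"
  have "\<xi> \<in> measurable M (restrict_space borel \<Xi>)"
    using assms by (intro measurable_restrict_space2)
  then have meas: "\<xi> \<in> measurable M ?L"
    by simp
  have eq: "distr M ?L \<xi> = ?L"
    by (rule distr_cong) simp_all
  show "\<xi> \<in> measurable M (law M \<Xi> \<xi>)"
    unfolding law_def by (rule measurable_completion2[OF meas]) (simp add: eq)
  show "distr M (law M \<Xi> \<xi>) \<xi> = law M \<Xi> \<xi>"
    using completion_distr_eq[OF meas] unfolding law_def eq by simp
qed

theorem theorem3p2:
  fixes M :: "'w measure"
    and \<Xi> :: "(real ^ 'r) set"
    and \<xi> :: "'w \<Rightarrow> real ^ 'r"
    and X :: "'x::polish_space set"
    and f :: "real ^ 'r \<Rightarrow> 'x \<Rightarrow> ereal"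
    and N d :: nat
    and \<epsilon> \<delta> :: real
  assumes "prob_space M" and "complete_measure M"
    and "\<xi> \<in> borel_measurable M" and "\<xi> \<in> space M \<rightarrow> \<Xi>"
    and "closed X" and "X \<noteq> {}"
    and "\<And>z x. z \<in> \<Xi> \<Longrightarrow> x \<in> X \<Longrightarrow> f z x \<noteq> -\<infinity>"
    and "\<And>z. z \<in> \<Xi> \<Longrightarrow> lsc_on X (f z)"
    and "(\<lambda>(\<omega>, x). f (\<xi> \<omega>) x) \<in> borel_measurable (prod_completion M (restrict_space borel X))"
    and "{x\<in>X. ereal_expectation M (\<lambda>\<omega>. f (\<xi> \<omega>) x) < \<infinity>} \<noteq> {}"
    and "\<And>x. x \<in> X \<Longrightarrow> feasible_scenarios \<Xi> f x \<in> sets (law M \<Xi> \<xi>)"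
    and "sup_violation_event M \<Xi> \<xi> X f N \<epsilon> \<in> sets (sample_law M \<Xi> \<xi> N)"
    and "vc_dim (feasible_scenarios \<Xi> f ` X \<union> {\<Xi>}) = enat d"
    and "AE s in sample_law M \<Xi> \<xi> N. saa_dom X f N s \<noteq> {}"
    and "0 < \<delta>" and "\<delta> < 1" and "0 < \<epsilon>" and "\<epsilon> < 1"
    and "real N \<ge> 4 / \<epsilon> * (real d * ln (12 / \<epsilon>) + ln (2 / \<delta>))"
  shows "measure (sample_law M \<Xi> \<xi> N) (sup_violation_event M \<Xi> \<xi> X f N \<epsilon>) \<le> \<delta> \<and>
    (\<forall>xstar. xstar \<in> space (sample_law M \<Xi> \<xi> N) \<rightarrow> X \<longrightarrow>
       (\<forall>s\<in>space (sample_law M \<Xi> \<xi> N). saa_dom X f N s \<noteq> {} \<longrightarrow> xstar s \<in> saa_dom X f N s) \<longrightarrow>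
       output_violation_event M \<Xi> \<xi> X f N \<epsilon> xstar \<in> sets (sample_law M \<Xi> \<xi> N) \<longrightarrow>
       measure (sample_law M \<Xi> \<xi> N) (output_violation_event M \<Xi> \<xi> X f N \<epsilon> xstar) \<le> \<delta>)"
proof -
  interpret prob_space M by fact
  interpret complete_measure M by fact
  let ?I = "{1..N}"
  define L where "L = law M \<Xi> \<xi>"
  let ?PM = "Pi\<^sub>M ?I (\<lambda>_. M)" and ?PL = "Pi\<^sub>M ?I (\<lambda>_. L)"
  have \<xi>[measurable]: "\<xi> \<in> measurable M L" and distr_\<xi>: "distr M L \<xi> = L"
    unfolding L_def using assms(2-4) by (rule law_eq_distr)+
  have space_L: "space L = \<Xi>"
    by (simp add: L_def law_def space_restrict_space)
  have prob_L: "prob_space L"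
    using prob_space_distr[OF \<xi>] by (simp only: distr_\<xi>)
  have prob_PL: "prob_space ?PL"
    by (intro prob_space_PiM prob_L)
  have sample: "sample_law M \<Xi> \<xi> N = completion ?PL"
    by (simp add: sample_law_def L_def)
  have prob_sample: "prob_space (completion ?PL)"
    by (rule prob_space.prob_space_completion[OF prob_PL])

  define Q where "Q = sup_violation_event M \<Xi> \<xi> X f N \<epsilon>"
  have Q: "Q \<in> sets (completion ?PL)"
    using assms(12) by (simp add: Q_def sample)

  \<comment> \<open>Joint measurability of feasibility\<close>
  have X: "X \<in> sets borel"
    using \<open>closed X\<close> by simp
  let ?RX = "restrict_space borel X :: 'x measure"
  have "(\<lambda>(\<omega>, x). f (\<xi> \<omega>) x) -` {..<\<infinity>} \<inter> space (prod_completion M ?RX) \<in> sets (prod_completion M ?RX)"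
    using assms(9) by (rule measurable_sets) simp
  from prod_completion_mod_null[OF this] obtain Z E where Z: "Z \<in> null_sets M"
    and E: "E \<in> sets (M \<Otimes>\<^sub>M ?RX)"
    and ZE: "\<And>\<omega> x. \<omega> \<in> space M \<Longrightarrow> x \<in> space ?RX \<Longrightarrow> \<omega> \<notin> Z \<Longrightarrow>
      (\<omega>, x) \<in> (\<lambda>(\<omega>, x). f (\<xi> \<omega>) x) -` {..<\<infinity>} \<inter> space (prod_completion M ?RX) \<longleftrightarrow> (\<omega>, x) \<in> E"
    by metis
  \<comment> \<open>Removing the cylinder over \<open>Z\<close> gives a version of feasibility that
    is measurable in the uncompleted product; outcomes in \<open>Z\<close> count as infeasible for
    every \<open>x\<close>.\<close>
  define A where "A = E \<inter> ((space M - Z) \<times> UNIV)"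
  have "sets (M \<Otimes>\<^sub>M ?RX) \<subseteq> sets (M \<Otimes>\<^sub>M borel)"
    using X by (intro sets_pair_in_sets pair_measureI) (auto simp: sets_restrict_space_iff)
  moreover have "(space M - Z) \<times> UNIV \<in> sets (M \<Otimes>\<^sub>M borel)"
    using Z by (intro pair_measureI) auto
  ultimately have A[measurable]: "A \<in> sets (M \<Otimes>\<^sub>M borel)"
    unfolding A_def using E by blast
  have mem_A: "(\<omega>, x) \<in> A \<longleftrightarrow> \<omega> \<in> space M \<and> \<omega> \<notin> Z \<and> f (\<xi> \<omega>) x < \<infinity>" if "x \<in> X" for \<omega> x
  proof -
    have space: "space (prod_completion M ?RX) = space M \<times> X"
      by (simp add: prod_completion_def space_restrict_space space_measure_of_conv)
    show ?thesis
    proof (cases "\<omega> \<in> space M - Z")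
      case True
      then show ?thesis
        using ZE[of \<omega> x] that by (simp add: A_def space space_restrict_space)
    qed (auto simp: A_def)
  qed

  \<comment> \<open>From samples of \<open>\<xi>\<close> to samples of outcomes\<close>
  define Q0 where "Q0 = main_part ?PL Q"
  \<comment> \<open>The main part of \<open>Q\<close> is measurable in the uncompleted product and
    has the same probability as \<open>Q\<close>.\<close>
  have Q0: "Q0 \<in> sets ?PL" "Q0 \<subseteq> Q"
    using main_part_sets[OF Q] main_part_null_part_Un[OF Q] by (auto simp: Q0_def)
  \<comment> \<open>Applying \<open>\<xi>\<close> to each coordinate maps the product of
    \<open>M\<close> to the product of the laws. This moves the problem to outcomes, where joint
    measurability is assumed.\<close>
  have comp: "compose ?I \<xi> \<in> measurable ?PM ?PL" "distr ?PM ?PL (compose ?I \<xi>) = ?PL"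
  proof -
    show "compose ?I \<xi> \<in> measurable ?PM ?PL"
      unfolding compose_def by measurable
    show "distr ?PM ?PL (compose ?I \<xi>) = ?PL"
      using distr_PiM_finite_prob_space'[of ?I "\<lambda>_. M" "\<lambda>_. L" \<xi>] prob_L prob_space_axioms \<xi>
      by (simp add: distr_\<xi>)
  qed
  define S0 where "S0 = compose ?I \<xi> -` Q0 \<inter> space ?PM"
  have S0[measurable]: "S0 \<in> sets ?PM"
    unfolding S0_def using comp(1) Q0(1) by (rule measurable_sets)
  \<comment> \<open>Samples that hit \<open>Z\<close> form a null set. Once they are discarded,
    feasibility at a sample point means membership in \<open>A\<close>.\<close>
  define S where "S = {s \<in> space ?PM. s \<in> S0 \<and> (\<forall>i\<in>?I. s i \<notin> Z)}"
  have [measurable]: "Z \<in> sets M"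
    using Z by auto
  have S: "S \<in> sets ?PM"
    unfolding S_def by measurable
  have "AE s in ?PM. \<forall>i\<in>?I. s i \<notin> Z"
  proof (rule AE_finite_allI)
    fix i assume "i \<in> ?I"
    then show "AE s in ?PM. s i \<notin> Z"
      using AE_not_in[OF Z] by (intro AE_PiM_component[where P="\<lambda>w. w \<notin> Z" and M="\<lambda>_. M"] prob_space_axioms)
  qed simp
  then have AE_S: "AE s in ?PM. s \<in> S0 \<longleftrightarrow> s \<in> S"
    using AE_space by eventually_elim (auto simp: S_def)
  have "emeasure (completion ?PL) Q = emeasure ?PL Q0"
    using Q by (simp add: Q0_def)
  also have "\<dots> = emeasure (distr ?PM ?PL (compose ?I \<xi>)) Q0"
    by (simp only: comp)
  also have "\<dots> = emeasure ?PM S0"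
    unfolding S0_def by (rule emeasure_distr[OF comp(1) Q0(1)])
  also have "\<dots> = emeasure ?PM S"
    using AE_S S0 S by (rule emeasure_eq_AE)
  finally have emeasure_Q: "emeasure (completion ?PL) Q = emeasure ?PM S" .

  \<comment> \<open>Uniform bound on the violation probability\<close>
  have "emeasure ?PM S * ennreal ((1 + \<epsilon>) ^ N) \<le> ennreal (\<Sum>i\<le>d. real ((2 * N) choose i))"
  proof (rule vc_symmetrization[OF X A S])
    show "0 \<le> \<epsilon>"
      using \<open>0 < \<epsilon>\<close> by simp
  next
    fix s assume "s \<in> S"
    then have s: "s \<in> space ?PM" "compose ?I \<xi> s \<in> Q" "\<And>i. i \<in> ?I \<Longrightarrow> s i \<notin> Z"
      using Q0(2) by (auto simp: S_def S0_def)
    then obtain x where x: "x \<in> saa_dom X f N (compose ?I \<xi> s)" "\<epsilon> < violation M \<Xi> \<xi> X f x"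
      by (auto simp: Q_def sup_violation_event_def less_SUP_iff)
    then have "x \<in> X"
      by (simp add: saa_dom_def)
    have "(s i, x) \<in> A" if "i \<in> ?I" for i
    proof -
      have "f (compose ?I \<xi> s i) x < \<infinity>"
        using x(1) that by (auto simp: saa_dom_def dom_at_def)
      moreover have "s i \<in> space M"
        using s(1) that by (auto simp: space_PiM)
      ultimately show ?thesis
        using s(3) that \<open>x \<in> X\<close> by (simp add: mem_A compose_def)
    qed
    moreover have "\<epsilon> \<le> prob {w \<in> space M. (w, x) \<notin> A}"
    proof -
      let ?B = "{z\<in>\<Xi>. x \<notin> dom_at X f z}"
      have "?B = space L - feasible_scenarios \<Xi> f x"
        using \<open>x \<in> X\<close> by (auto simp: space_L dom_at_def feasible_scenarios_def)
      then have B: "?B \<in> sets L"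
        using assms(11)[OF \<open>x \<in> X\<close>] by (simp add: L_def)
      have "violation M \<Xi> \<xi> X f x = measure (distr M L \<xi>) ?B"
        by (simp add: violation_def distr_\<xi>) (simp add: L_def)
      also have "\<dots> = prob (\<xi> -` ?B \<inter> space M)"
        by (rule measure_distr[OF \<xi> B])
      \<comment> \<open>Excluding \<open>Z\<close> from the sections of \<open>A\<close> can only
        enlarge their complements.\<close>
      also have "\<dots> \<le> prob {w \<in> space M. (w, x) \<notin> A}"
      proof (rule finite_measure_mono)
        show "\<xi> -` ?B \<inter> space M \<subseteq> {w \<in> space M. (w, x) \<notin> A}"
          using \<open>x \<in> X\<close> by (auto simp: mem_A dom_at_def)
        show "{w \<in> space M. (w, x) \<notin> A} \<in> sets M"
          by measurable
      qed
      finally show ?thesis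
        using x(2) by simp
    qed
    ultimately show "\<exists>x\<in>X. (\<forall>i\<in>?I. (s i, x) \<in> A) \<and> \<epsilon> \<le> prob {w \<in> space M. (w, x) \<notin> A}"
      using \<open>x \<in> X\<close> by blast
  next
    fix K assume K: "K \<subseteq> space M" "shatters ((\<lambda>x. {w \<in> space M. (w, x) \<in> A}) ` X) K"
    let ?H = "feasible_scenarios \<Xi> f ` X \<union> {\<Xi>}"
    have fin: "finite K"
      using K(2) by (simp add: shatters_alt)
    have trace: "\<exists>x\<in>X. {w \<in> space M. (w, x) \<in> A} \<inter> K = D" if "D \<subseteq> K" for D
      using shattersD[OF K(2) that] by simp
    \<comment> \<open>No section of \<open>A\<close> over \<open>X\<close> meets \<open>Z\<close>,
      and some section contains all of \<open>K\<close>, so \<open>K\<close> avoids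
      \<open>Z\<close>.\<close>
    from trace[of K] obtain y where "y \<in> X" "{w \<in> space M. (w, y) \<in> A} \<inter> K = K"
      by blast
    then have KZ: "k \<notin> Z" if "k \<in> K" for k
      using that by (auto simp: mem_A)
    have "\<exists>C\<in>?H. \<forall>k\<in>K. \<xi> k \<in> C \<longleftrightarrow> k \<in> D" if D: "D \<subseteq> K" for D
    proof -
      from trace[OF D] obtain x where x: "x \<in> X" "{w \<in> space M. (w, x) \<in> A} \<inter> K = D"
        by blast
      have "\<xi> k \<in> feasible_scenarios \<Xi> f x \<longleftrightarrow> k \<in> D" if "k \<in> K" for k
      proof -
        have "k \<in> space M" "\<xi> k \<in> \<Xi>"
          using that K(1) assms(4) by auto
        have "k \<in> D \<longleftrightarrow> k \<in> {w \<in> space M. (w, x) \<in> A} \<inter> K"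
          by (simp only: x(2))
        also have "\<dots> \<longleftrightarrow> f (\<xi> k) x < \<infinity>"
          using that \<open>k \<in> space M\<close> KZ[OF that] by (simp add: mem_A[OF x(1)])
        finally show ?thesis
          using \<open>\<xi> k \<in> \<Xi>\<close> by (simp add: feasible_scenarios_def)
      qed
      with x(1) show ?thesis
        by blast
    qed
    \<comment> \<open>All patterns on \<open>K\<close> are patterns of scenario sets on the images
      under \<open>\<xi>\<close>. Injectivity on \<open>K\<close> preserves the cardinality, so the
      VC dimension bounds \<open>card K\<close>.\<close>
    from shatters_image[OF fin this] have "inj_on \<xi> K" "shatters ?H (\<xi> ` K)"
      by blast+
    then show "card K \<le> d"
      using card_le_vc_dim[OF assms(13)] by (metis card_image)
  qed
  also have "\<dots> \<le> ennreal (\<delta> * (1 + \<epsilon>) ^ N)"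
  proof (intro ennreal_leI sample_size_bound)
    have "ln (12 / \<epsilon>) \<ge> 0" "ln (2 / \<delta>) \<ge> 0"
      using assms(15-18) by (auto intro!: ln_ge_zero simp: field_simps)
    then show "real d * ln (12 / \<epsilon>) + ln (2 / \<delta>) \<ge> 0"
      by simp
  qed (use assms in auto)
  also have "\<dots> = ennreal \<delta> * ennreal ((1 + \<epsilon>) ^ N)"
    using assms(15,17) by (intro ennreal_mult) auto
  finally have "emeasure ?PM S \<le> ennreal \<delta>"
    using assms(17) by (simp add: ennreal_mult_le_mult_iff mult.commute[of _ "ennreal ((1 + \<epsilon>) ^ N)"])
  then have "measure (completion ?PL) Q \<le> \<delta>"
    unfolding measure_def emeasure_Q using \<open>0 < \<delta>\<close> by (intro enn2real_leI) simp_all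
  then have main: "measure (sample_law M \<Xi> \<xi> N) Q \<le> \<delta>"
    by (simp only: sample)

  \<comment> \<open>The output of an algorithm\<close>
  have output_le: "measure (sample_law M \<Xi> \<xi> N) (output_violation_event M \<Xi> \<xi> X f N \<epsilon> xstar) \<le> \<delta>"
    if xstar: "\<forall>s\<in>space (sample_law M \<Xi> \<xi> N). saa_dom X f N s \<noteq> {} \<longrightarrow> xstar s \<in> saa_dom X f N s" for xstar
  proof -
    interpret sample: prob_space "sample_law M \<Xi> \<xi> N"
      using prob_sample by (simp only: sample)
    \<comment> \<open>Almost surely the feasible region is nonempty and contains
      \<open>xstar s\<close>, whose violation probability is then at most the supremum.\<close>
    have "AE s in sample_law M \<Xi> \<xi> N. s \<in> output_violation_event M \<Xi> \<xi> X f N \<epsilon> xstar \<longrightarrow> s \<in> Q"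
      using assms(14)
    proof eventually_elim
      case (elim s)
      show ?case
      proof
        assume "s \<in> output_violation_event M \<Xi> \<xi> X f N \<epsilon> xstar"
        then have s: "s \<in> space (sample_law M \<Xi> \<xi> N)" "\<epsilon> < violation M \<Xi> \<xi> X f (xstar s)"
          by (auto simp: output_violation_event_def)
        then have "xstar s \<in> saa_dom X f N s"
          using xstar elim by blast
        with s show "s \<in> Q"
          by (auto simp: Q_def sup_violation_event_def less_SUP_iff)
      qed
    qed
    then have "measure (sample_law M \<Xi> \<xi> N) (output_violation_event M \<Xi> \<xi> X f N \<epsilon> xstar)
        \<le> measure (sample_law M \<Xi> \<xi> N) Q"
      using Q by (intro sample.finite_measure_mono_AE) (simp_all add: sample)
    also note main
    finally show ?thesis .
  qed
  show ?thesis
  proof (intro conjI allI impI)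
    show "measure (sample_law M \<Xi> \<xi> N) (sup_violation_event M \<Xi> \<xi> X f N \<epsilon>) \<le> \<delta>"
      using main by (simp only: Q_def)
  next
    fix xstar
    assume "\<forall>s\<in>space (sample_law M \<Xi> \<xi> N). saa_dom X f N s \<noteq> {} \<longrightarrow> xstar s \<in> saa_dom X f N s"
    then show "measure (sample_law M \<Xi> \<xi> N) (output_violation_event M \<Xi> \<xi> X f N \<epsilon> xstar) \<le> \<delta>"
      by (rule output_le)
  qed
qed

end
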